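(* Let $k, D, d, z \in \mathbb{N}$ with $k \geq 2$ and $z \leq \left\lfloor \frac{d-1}{k+1} \right\rfloor$, and let $\epsilon > 0$. Then there exist simple graphs $G$ with $\gamma(G) < k + \frac{d}{d+k+1} + \epsilon$ such that in every decomposition of $G$ into $k+1$ pseudoforests in which one pseudoforest $F$ has maximum degree at most $D$, the pseudoforest $F$ has a connected component $K$ with $e(K) \geq d - z(k-1) + 1$ and $\mathrm{diam}(K) \geq 2(z+1)$.
   Context: A pseudoforest is a graph in which every connected component contains at most one cycle; a decomposition of $G$ is a partition of $E(G)$. The fractional arboricity of $G$ is $\gamma(G) = \max\{ e(H)/(v(H)-1) : H \subseteq G,\ v(H) \geq 2\}$, where $e(H), v(H)$ are the numbers of edges and vertices of $H$. $\mathrm{diam}(K)$ is the maximum distance between two vertices of the connected graph $K$. *)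

theory Defs
  imports Complex_Main
begin

datatype 'a ugraph = UGraph (verts: "'a set") (edges: "'a set set")

definition simple_graph :: "'a ugraph \<Rightarrow> bool" where
  "simple_graph G \<longleftrightarrow> finite (verts G) \<and> (\<forall>e\<in>edges G. e \<subseteq> verts G \<and> card e = 2)"

definition subgraph :: "'a ugraph \<Rightarrow> 'a ugraph \<Rightarrow> bool" where
  "subgraph H G \<longleftrightarrow> simple_graph H \<and> verts H \<subseteq> verts G \<and> edges H \<subseteq> edges G"

text \<open>As in the literature, this is only meaningful for graphs with at least two vertices
  (otherwise the maximum is over the empty set).\<close>

definition fractional_arboricity :: "'a ugraph \<Rightarrow> real" where
  "fractional_arboricity G =
     Max {real (card (edges H)) / (real (card (verts H)) - 1) |H.
            subgraph H G \<and> card (verts H) \<ge> 2}"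

text \<open>Walks are given by their nonempty vertex sequences; the number of edges of the walk
  \<open>xs\<close> is \<open>length xs - 1\<close>.\<close>

definition walk_between :: "'a ugraph \<Rightarrow> 'a \<Rightarrow> 'a list \<Rightarrow> 'a \<Rightarrow> bool" where
  "walk_between G u xs v \<longleftrightarrow>
     xs \<noteq> [] \<and> hd xs = u \<and> last xs = v \<and> set xs \<subseteq> verts G \<and>
     successively (\<lambda>x y. {x, y} \<in> edges G) xs"

definition connected_graph :: "'a ugraph \<Rightarrow> bool" where
  "connected_graph G \<longleftrightarrow>
     verts G \<noteq> {} \<and> (\<forall>u\<in>verts G. \<forall>v\<in>verts G. \<exists>xs. walk_between G u xs v)"

definition component :: "'a ugraph \<Rightarrow> 'a ugraph \<Rightarrow> bool" where
  "component K G \<longleftrightarrow>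
     subgraph K G \<and> connected_graph K \<and>
     (\<forall>H. subgraph H G \<and> connected_graph H \<and> subgraph K H \<longrightarrow> H = K)"

definition graph_dist :: "'a ugraph \<Rightarrow> 'a \<Rightarrow> 'a \<Rightarrow> nat" where
  "graph_dist G u v = (LEAST n. \<exists>xs. walk_between G u xs v \<and> length xs = Suc n)"

definition diam :: "'a ugraph \<Rightarrow> nat" where
  "diam K = Max {graph_dist K u v |u v. u \<in> verts K \<and> v \<in> verts K}"

text \<open>A cycle is a graph rather than a vertex sequence, so that rotations and reversals of the
  same sequence do not count as different cycles.\<close>

definition is_cycle :: "'a ugraph \<Rightarrow> bool" where
  "is_cycle C \<longleftrightarrow>
     (\<exists>xs. distinct xs \<and> length xs \<ge> 3 \<and> verts C = set xs \<and>
           edges C = {{xs ! i, xs ! (Suc i mod length xs)} |i. i < length xs})"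

definition pseudoforest :: "'a ugraph \<Rightarrow> bool" where
  "pseudoforest G \<longleftrightarrow>
     simple_graph G \<and>
     (\<forall>K. component K G \<longrightarrow>
        (\<forall>C C'. is_cycle C \<and> subgraph C K \<and> is_cycle C' \<and> subgraph C' K \<longrightarrow> C = C'))"

text \<open>The parts of a decomposition are spanning subgraphs, indexed by \<open>i < n\<close>; parts without
  edges are allowed.\<close>

definition pseudoforest_decomposition :: "'a ugraph \<Rightarrow> nat \<Rightarrow> (nat \<Rightarrow> 'a ugraph) \<Rightarrow> bool" where
  "pseudoforest_decomposition G n P \<longleftrightarrow>
     (\<forall>i<n. verts (P i) = verts G \<and> pseudoforest (P i)) \<and>
     (\<Union>i<n. edges (P i)) = edges G \<and>
     (\<forall>i<n. \<forall>j<n. i \<noteq> j \<longrightarrow> edges (P i) \<inter> edges (P j) = {})"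

definition degree :: "'a ugraph \<Rightarrow> 'a \<Rightarrow> nat" where
  "degree G v = card {e \<in> edges G. v \<in> e}"

text \<open>The inserted \<open>0\<close> only matters for the graph without vertices.\<close>

definition max_degree :: "'a ugraph \<Rightarrow> nat" where
  "max_degree G = Max (insert 0 (degree G ` verts G))"

end

theory Submission
  imports Defs "HOL-Library.Countable"
begin

text \<open>A pseudoforest has an injective choice of an end (``owner'') of each edge, so in a decomposition every
  vertex owns at most \<open>k\<close> of the edges outside \<open>F\<close>.  The graph consists of \<open>k\<close> hubs and many disjoint
  chains of \<open>L\<close> units.  A unit is a centre with \<open>k + 1\<close> legs of \<open>z + 1\<close> vertices and
  \<open>l = d - z (k + 1) - 1\<close> pendant vertices; every branch vertex is joined to its predecessor and to
  \<open>k\<close> hubs, except that the first vertex of leg \<open>0\<close> is joined to the next centre instead of one hub.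
  One extra leg hangs on the first centre.  A unit has \<open>d + k + 1\<close> vertices and \<open>(k + 1) (d + k)\<close> edges,
  so its density is exactly \<open>k + d / (d + k + 1)\<close>; the extra leg pays off only in a subgraph that contains
  a whole chain, whence its contribution is negligible for large \<open>L\<close>.

  The hubs meet few edges of \<open>F\<close> and own few edges, so in some chain all edges to hubs are owned by the
  chain.  There the branch vertices cannot own more, and each centre can cut off at most \<open>k\<close> of its
  branches.  Going up the chain from its last unit, the component of each centre in \<open>F\<close> therefore contains
  the tip of a leg and at least \<open>z + 1 + l\<close> edges, and one leg more in that component gives
  the desired component.  The extra leg at the beginning of the chain is such a leg, unless
  this happened before.\<close>

subsection \<open>Owners of the edges of a pseudoforest\<close>

definition linked :: "'a set set \<Rightarrow> 'a \<Rightarrow> 'a \<Rightarrow> bool" where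
  "linked E = (\<lambda>x y. {x, y} \<in> E)\<^sup>*\<^sup>*"

lemma linked_refl [simp]: "linked E x x"
  by (simp add: linked_def)

lemma linked_edge: "{x, y} \<in> E \<Longrightarrow> linked E x y"
  by (auto simp: linked_def)

lemma linked_trans [trans]: "linked E x y \<Longrightarrow> linked E y w \<Longrightarrow> linked E x w"
  by (simp add: linked_def)

lemma linked_sym: "linked E x y \<Longrightarrow> linked E y x"
  unfolding linked_def
proof (induction rule: rtranclp_induct)
  case (step y w)
  then have "{w, y} \<in> E"
    by (simp add: insert_commute)
  then show ?case
    using step.IH by (rule converse_rtranclp_into_rtranclp)
qed simp

lemma linked_mono: "linked E x y \<Longrightarrow> E \<subseteq> E' \<Longrightarrow> linked E' x y"
  unfolding linked_def by (erule mono_rtranclp[rule_format, rotated]) auto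

definition cycle_edges :: "'a list \<Rightarrow> 'a set set" where
  "cycle_edges xs = {{xs ! i, xs ! (Suc i mod length xs)} |i. i < length xs}"

definition cycle_in :: "'a set set \<Rightarrow> 'a list \<Rightarrow> bool" where
  "cycle_in E xs \<longleftrightarrow> distinct xs \<and> 3 \<le> length xs \<and> cycle_edges xs \<subseteq> E"

lemma cycle_in_mono: "cycle_in E xs \<Longrightarrow> E \<subseteq> E' \<Longrightarrow> cycle_in E' xs"
  by (auto simp: cycle_in_def)

lemma cycle_in_linked:
  assumes "cycle_in E xs" "x \<in> set xs"
  shows "linked E (hd xs) x"
proof -
  have "linked E (xs ! 0) (xs ! i)" if "i < length xs" for i
    using that
  proof (induction i)
    case (Suc i)
    then have "{xs ! i, xs ! (Suc i mod length xs)} \<in> cycle_edges xs"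
      unfolding cycle_edges_def by (auto intro: exI[of _ i])
    then have "{xs ! i, xs ! Suc i} \<in> E"
      using assms(1) Suc.prems by (auto simp: cycle_in_def)
    then show ?case
      using Suc by (meson Suc_lessD linked_edge linked_trans)
  qed simp
  moreover have "hd xs = xs ! 0"
    using assms(2) by (cases xs) auto
  ultimately show ?thesis
    using assms(2) by (auto simp: in_set_conv_nth)
qed

lemma card_2_other:
  assumes "card e = 2" "x \<in> e"
  obtains y where "e = {x, y}" "y \<noteq> x"
  using assms by (metis card_2_iff' insertE insert_commute singletonD card_2_iff)

text \<open>The first vertex of a longest path meets a second edge. By maximality the other end of
  that edge lies on the path, and the initial segment up to it closes to a cycle.\<close>

lemma exists_cycle:
  assumes fin: "finite E" and ne: "E \<noteq> {}" and two: "\<And>e. e \<in> E \<Longrightarrow> card e = 2"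
    and no_leaf: "\<And>x e. e \<in> E \<Longrightarrow> x \<in> e \<Longrightarrow> \<exists>e'\<in>E. x \<in> e' \<and> e' \<noteq> e"
  shows "\<exists>xs. cycle_in E xs"
proof -
  define path where "path xs \<longleftrightarrow> distinct xs \<and> set xs \<subseteq> \<Union> E \<and> successively (\<lambda>x y. {x, y} \<in> E) xs"
    for xs
  have finU: "finite (\<Union> E)"
    using fin two by (metis card.infinite finite_Union zero_neq_numeral)
  have bound: "length xs < Suc (card (\<Union> E))" if "path xs" for xs
    using that finU unfolding path_def by (metis card_mono distinct_card le_imp_less_Suc)
  obtain u v where uv: "{u, v} \<in> E" "u \<noteq> v"
    using ne two by (metis all_not_in_conv card_2_iff)
  have p0: "path [u, v]"
    using uv by (auto simp: path_def)
  obtain xs where xs: "path xs" and longest: "\<And>ys. path ys \<Longrightarrow> length ys \<le> length xs"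
    using ex_has_greatest_nat[of path, OF p0, of length "Suc (card (\<Union> E))"] bound
    by (metis less_imp_le_nat)
  have "length xs \<ge> 2"
    using longest[OF p0] by simp
  then obtain x y ys where xs_eq: "xs = x # y # ys"
    by (metis Suc_le_length_iff numeral_2_eq_2)
  have xy: "{x, y} \<in> E"
    using xs by (simp add: path_def xs_eq)
  obtain e where e: "e \<in> E" "x \<in> e" "e \<noteq> {x, y}"
    using no_leaf[OF xy] by auto
  then obtain w where w: "e = {x, w}" "w \<noteq> x"
    using card_2_other[OF two[OF e(1)] e(2)] by metis
  have "w \<noteq> y"
    using e w by auto
  have "w \<in> set xs"
  proof (rule ccontr)
    assume "w \<notin> set xs"
    then have "path (w # xs)"
      using xs e w by (auto simp: path_def xs_eq insert_commute)
    then show False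
      using longest by fastforce
  qed
  then obtain i where i: "i < length xs" "xs ! i = w"
    by (auto simp: in_set_conv_nth)
  \<comment> \<open>Index 0 is excluded by \<open>w \<noteq> x\<close> and index 1 by
    \<open>e \<noteq> {x, y}\<close>, so the closed walk has at least three vertices.\<close>
  have "i \<noteq> 0" "i \<noteq> 1"
    using i \<open>w \<noteq> y\<close> w(2) unfolding xs_eq by (metis nth_Cons_0, metis One_nat_def nth_Cons_0 nth_Cons_Suc)
  then have "i \<ge> 2"
    by simp
  define c where "c = take (Suc i) xs"
  have len: "length c = Suc i"
    using i by (simp add: c_def)
  have "{c ! j, c ! (Suc j mod length c)} \<in> E" if "j < length c" for j
  proof (cases "j = i")
    case True
    then show ?thesis
      using i w e len by (simp add: c_def xs_eq insert_commute flip: take_Suc_Cons)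
  next
    case False
    then have "j < i"
      using that len by simp
    then have "{xs ! j, xs ! Suc j} \<in> E"
      using xs i by (auto simp: path_def successively_conv_nth)
    then show ?thesis
      using \<open>j < i\<close> len by (simp add: c_def)
  qed
  then have "cycle_in E c"
    using xs \<open>i \<ge> 2\<close> len unfolding cycle_in_def cycle_edges_def by (auto simp: c_def path_def)
  then show ?thesis ..
qed

text \<open>The set \<open>R\<close> of forbidden owners is what makes the induction work: deleting an edge of a cycle
  turns one of its ends into the root of a tree.\<close>

lemma exists_owner_avoiding:
  assumes "finite E" and "\<And>e. e \<in> E \<Longrightarrow> card e = 2"
    and "\<And>xs ys. cycle_in E xs \<Longrightarrow> cycle_in E ys \<Longrightarrow> linked E (hd xs) (hd ys) \<Longrightarrow>
           cycle_edges xs = cycle_edges ys"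
    and "\<And>x y. x \<in> R \<Longrightarrow> y \<in> R \<Longrightarrow> linked E x y \<Longrightarrow> x = y"
    and "\<And>x xs. x \<in> R \<Longrightarrow> cycle_in E xs \<Longrightarrow> \<not> linked E x (hd xs)"
  shows "\<exists>own. (\<forall>e\<in>E. own e \<in> e - R) \<and> inj_on own E"
  using assms
proof (induction E arbitrary: R rule: finite_psubset_induct)
  case (psubset E)
  note two = psubset.prems(1) and unique = psubset.prems(2) and root = psubset.prems(3)
    and root_cycle = psubset.prems(4)
  \<comment> \<open>As long as edges are left, each case removes one edge \<open>e\<close>, finds
    owners for the others that avoid one end \<open>x\<close> of \<open>e\<close>, and gives
    \<open>e\<close> to \<open>x\<close>.\<close>
  have extend: ?case
    if e: "e \<in> E" and x: "x \<in> e" "x \<notin> R"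
      and own: "\<forall>e'\<in>E - {e}. own e' \<in> e' - R \<and> own e' \<noteq> x" "inj_on own (E - {e})" for e x own
  proof -
    have "E = insert e (E - {e})"
      using e by auto
    moreover have "inj_on (own(e := x)) (insert e (E - {e}))"
      using own by (auto simp: inj_on_def)
    moreover have "\<forall>e'\<in>E. (own(e := x)) e' \<in> e' - R"
      using own x by auto
    ultimately show ?thesis
      by (metis (no_types))
  qed
  have sub: "E - {e} \<subset> E" "E - {e} \<subseteq> E" if "e \<in> E" for e
    using that by auto
  have unique': "cycle_edges xs = cycle_edges ys"
    if "cycle_in (E - {e}) xs" "cycle_in (E - {e}) ys" "linked (E - {e}) (hd xs) (hd ys)" for e xs ys
    using that unique by (meson Diff_subset cycle_in_mono linked_mono)
  have down: "linked (E - {e}) x y \<Longrightarrow> linked E x y" "cycle_in (E - {e}) xs \<Longrightarrow> cycle_in E xs"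
    for e x y xs
    by (auto elim: linked_mono cycle_in_mono)
  have ih: "\<exists>own. (\<forall>e'\<in>E - {e}. own e' \<in> e' - R') \<and> inj_on own (E - {e})"
    if "e \<in> E" "\<And>x y. x \<in> R' \<Longrightarrow> y \<in> R' \<Longrightarrow> linked (E - {e}) x y \<Longrightarrow> x = y"
      "\<And>x xs. x \<in> R' \<Longrightarrow> cycle_in (E - {e}) xs \<Longrightarrow> \<not> linked (E - {e}) x (hd xs)" for e R'
    by (rule psubset.IH[OF sub(1)[OF that(1)] two unique' that(2,3)]) auto
  show ?case
  proof (cases "\<exists>e\<in>E. \<exists>x\<in>e. \<forall>e'\<in>E. x \<in> e' \<longrightarrow> e' = e")
    case True
    then obtain e x where e: "e \<in> E" "x \<in> e" and leaf: "\<And>e'. e' \<in> E \<Longrightarrow> x \<in> e' \<Longrightarrow> e' = e"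
      by blast
    then obtain y where y: "e = {x, y}" "y \<noteq> x"
      using card_2_other[OF two[OF e(1)] e(2)] by metis
    have lxy: "linked E x y" "linked E y x"
      using linked_edge[of x y E] linked_sym[of E x y] e(1) unfolding y(1) by auto
    show ?thesis
    proof (cases "x \<in> R")
      case False
      have r1: "a = b" if "a \<in> R" "b \<in> R" "linked (E - {e}) a b" for a b
        by (rule root[OF that(1,2) down(1)[OF that(3)]])
      have r2: "\<not> linked (E - {e}) a (hd xs)" if "a \<in> R" "cycle_in (E - {e}) xs" for a xs
        using root_cycle[OF that(1) down(2)[OF that(2)]] down(1) by blast
      obtain own where "\<forall>e'\<in>E - {e}. own e' \<in> e' - R" "inj_on own (E - {e})"
        using ih[OF e(1) r1 r2] by blast
      then show ?thesis
        using extend[OF e False] leaf by (metis DiffD1 DiffD2 insertI1)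
    next
      case True
      have "y \<notin> R"
        using root[OF True _ lxy(1)] y(2) by auto
      \<comment> \<open>The leaf \<open>x\<close> may not own \<open>e\<close>, so \<open>y\<close>
        must, and \<open>y\<close> takes over from \<open>x\<close> as the forbidden vertex of what
        is left of the component.\<close>
      define R' where "R' = insert y (R - {x})"
      have r1: "a = b" if "a \<in> R'" "b \<in> R'" "linked (E - {e}) a b" for a b
      proof -
        have ab: "linked E a b" "linked E b a"
          using that(3) down linked_sym by metis+
        have "\<not> linked E c y" if "c \<in> R - {x}" for c
          using root[OF _ True] that linked_trans[OF _ lxy(2)] by blast
        then show ?thesis
          using that ab root by (auto simp: R'_def)
      qed
      have r2: "\<not> linked (E - {e}) a (hd xs)" if "a \<in> R'" "cycle_in (E - {e}) xs" for a xs
        using that root_cycle True down lxy by (metis Diff_iff R'_def insertE linked_trans)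
      obtain own where own: "\<forall>e'\<in>E - {e}. own e' \<in> e' - R'" "inj_on own (E - {e})"
        using ih[OF e(1) r1 r2] by blast
      have "\<forall>e'\<in>E - {e}. own e' \<in> e' - R \<and> own e' \<noteq> y"
      proof
        fix e' assume e': "e' \<in> E - {e}"
        then have "own e' \<in> e'" "own e' \<notin> R'"
          using own(1) by auto
        moreover have "x \<notin> e'"
          using leaf[of e'] e' by auto
        ultimately show "own e' \<in> e' - R \<and> own e' \<noteq> y"
          by (auto simp: R'_def)
      qed
      then show ?thesis
        using extend[OF e(1) _ \<open>y \<notin> R\<close> _ own(2)] y by blast
    qed
  next
    case no_leaf: False
    show ?thesis
    proof (cases "E = {}")
      case False
      obtain xs where xs: "cycle_in E xs"
        using exists_cycle[OF psubset.hyps(1) False two] no_leaf by metis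
      define x e where "x = xs ! 0" and "e = {xs ! 0, xs ! (Suc 0 mod length xs)}"
      have "length xs \<ge> 3"
        using xs by (simp add: cycle_in_def)
      then have e_in: "e \<in> cycle_edges xs" and x: "x = hd xs"
        unfolding cycle_edges_def e_def x_def by (cases xs; auto intro: exI[of _ 0])+
      then have e: "e \<in> E" "x \<in> e"
        using xs by (auto simp: cycle_in_def e_def x_def)
      have "x \<notin> R"
        using root_cycle xs x linked_refl by metis
      \<comment> \<open>Once \<open>e\<close> is deleted, the component of \<open>x\<close> contains
        neither a cycle nor a vertex of \<open>R\<close>. So \<open>x\<close> is admissible as a
        further forbidden vertex, which keeps it free to own \<open>e\<close>.\<close>
      define R' where "R' = insert x R"
      have nl: "\<not> linked E a x" if "a \<in> R" for a
        using root_cycle that xs x by metis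
      have r1: "a = b" if "a \<in> R'" "b \<in> R'" "linked (E - {e}) a b" for a b
      proof -
        have "linked E a b" "linked E b a"
          using down(1)[OF that(3)] linked_sym by auto
        then show ?thesis
          using that(1,2) nl root unfolding R'_def by blast
      qed
      have r2: "\<not> linked (E - {e}) a (hd ys)" if a: "a \<in> R'" and ys: "cycle_in (E - {e}) ys" for a ys
      proof
        assume l: "linked (E - {e}) a (hd ys)"
        show False
        proof (cases "a = x")
          case True
          then have "cycle_edges xs = cycle_edges ys"
            using unique[OF xs down(2)[OF ys]] down(1)[OF l] x by simp
          then show False
            using ys e_in by (auto simp: cycle_in_def)
        next
          case False
          then show False
            using root_cycle[OF _ down(2)[OF ys]] a down(1)[OF l] unfolding R'_def by blast
        qed
      qed
      obtain own where own: "\<forall>e'\<in>E - {e}. own e' \<in> e' - R'" "inj_on own (E - {e})"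
        using ih[OF e(1) r1 r2] by blast
      have "\<forall>e'\<in>E - {e}. own e' \<in> e' - R \<and> own e' \<noteq> x"
        using own(1) by (auto simp: R'_def)
      then show ?thesis
        using extend[OF e \<open>x \<notin> R\<close> _ own(2)] by blast
    qed auto
  qed
qed

subsection \<open>Components and diameter\<close>

definition component_of :: "'a ugraph \<Rightarrow> 'a \<Rightarrow> 'a ugraph" where
  "component_of G x = UGraph {y \<in> verts G. linked (edges G) x y}
     {e \<in> edges G. \<forall>y\<in>e. linked (edges G) x y}"

lemma walk_linked:
  assumes "successively (\<lambda>x y. {x, y} \<in> E) xs" "xs \<noteq> []"
  shows "linked E (hd xs) (last xs)"
  using assms
proof (induction xs rule: induct_list012)
  case (3 x y zs)
  then show ?case
    by (auto intro: linked_trans[OF linked_edge])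
qed auto

lemma linked_walk:
  assumes "linked E u v"
  shows "\<exists>xs. xs \<noteq> [] \<and> hd xs = u \<and> last xs = v \<and> successively (\<lambda>x y. {x, y} \<in> E) xs \<and>
           (\<forall>w\<in>set xs. linked E u w)"
  using assms unfolding linked_def
proof (induction rule: rtranclp_induct)
  case base
  show ?case by (rule exI[of _ "[u]"]) simp
next
  case (step v w)
  then obtain xs where "xs \<noteq> []" "hd xs = u" "last xs = v" "successively (\<lambda>x y. {x, y} \<in> E) xs"
    "\<forall>w\<in>set xs. (\<lambda>x y. {x, y} \<in> E)\<^sup>*\<^sup>* u w"
    by blast
  then show ?case
    using step.hyps
    by (intro exI[of _ "xs @ [w]"])
      (auto simp: successively_append_iff intro: rtranclp.rtrancl_into_rtrancl)
qed

lemma linked_in_verts: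
  assumes "linked (edges G) x y" "simple_graph G" "x \<in> verts G"
  shows "y \<in> verts G"
  using assms(1) unfolding linked_def
proof (induction rule: rtranclp_induct)
  case (step y w)
  then show ?case
    using assms(2) by (auto simp: simple_graph_def)
qed (use assms in simp)

lemma component_component_of:
  assumes G: "simple_graph G" and x: "x \<in> verts G"
  shows "component (component_of G x) G"
proof -
  let ?K = "component_of G x"
  have sub: "subgraph ?K G"
    using G unfolding subgraph_def simple_graph_def component_of_def
    by (auto intro: finite_subset[of _ "verts G"])
  have conn: "connected_graph ?K"
    unfolding connected_graph_def
  proof (intro conjI ballI)
    show "verts ?K \<noteq> {}"
      using x by (auto simp: component_of_def)
    fix u v assume "u \<in> verts ?K" "v \<in> verts ?K"
    then have xu: "linked (edges G) x u" and uv: "linked (edges G) u v" and u: "u \<in> verts G"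
      by (auto simp: component_of_def intro: linked_trans linked_sym)
    obtain xs where xs: "xs \<noteq> []" "hd xs = u" "last xs = v"
      "successively (\<lambda>x y. {x, y} \<in> edges G) xs" and l: "\<forall>w\<in>set xs. linked (edges G) u w"
      using linked_walk[OF uv] by blast
    have l': "linked (edges G) x w" if "w \<in> set xs" for w
      using that l xu linked_trans by metis
    have "set xs \<subseteq> verts ?K"
      using l l' linked_in_verts[OF _ G u] by (auto simp: component_of_def)
    moreover have "successively (\<lambda>x y. {x, y} \<in> edges ?K) xs"
      using xs(4) by (rule successively_mono) (auto simp: component_of_def l')
    ultimately show "\<exists>xs. walk_between ?K u xs v"
      using xs by (auto simp: walk_between_def)
  qed
  have "H = ?K" if H: "subgraph H G" "connected_graph H" "subgraph ?K H" for H
  proof -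
    have xH: "x \<in> verts H"
      using H(3) x by (auto simp: subgraph_def component_of_def)
    have lH: "linked (edges G) x v" if v: "v \<in> verts H" for v
    proof -
      obtain xs where xs: "walk_between H x xs v"
        using H(2) xH v unfolding connected_graph_def by blast
      then have "linked (edges H) x v"
        using walk_linked by (auto simp: walk_between_def)
      then show ?thesis
        by (rule linked_mono) (use H in \<open>auto simp: subgraph_def\<close>)
    qed
    have "verts H = verts ?K"
      using H lH by (auto simp: subgraph_def component_of_def)
    moreover have "edges H = edges ?K"
    proof
      show "edges H \<subseteq> edges ?K"
        using H(1) lH by (fastforce simp: subgraph_def simple_graph_def component_of_def)
      show "edges ?K \<subseteq> edges H"
        using H(3) by (simp add: subgraph_def)
    qed
    ultimately show ?thesis
      by (simp add: ugraph.expand)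
  qed
  then show ?thesis
    using sub conn by (auto simp: component_def)
qed

text \<open>The bound is asked of all walks because \<open>graph_dist\<close> is a least walk
  length; \<open>n < length xs\<close> says that the walk has at least \<open>n\<close>
  edges.\<close>

lemma diam_ge:
  assumes conn: "connected_graph K" and fin: "finite (verts K)" and uv: "u \<in> verts K" "v \<in> verts K"
    and far: "\<And>xs. walk_between K u xs v \<Longrightarrow> n < length xs"
  shows "n \<le> diam K"
proof -
  obtain xs where xs: "walk_between K u xs v"
    using conn uv by (auto simp: connected_graph_def)
  then have "xs \<noteq> []"
    by (simp add: walk_between_def)
  then have "\<exists>m. \<exists>xs. walk_between K u xs v \<and> length xs = Suc m"
    using xs by (metis Suc_pred length_greater_0_conv)
  then have "\<exists>xs. walk_between K u xs v \<and> length xs = Suc (graph_dist K u v)"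
    unfolding graph_dist_def by (rule LeastI_ex)
  then have "n \<le> graph_dist K u v"
    using far by fastforce
  also have "\<dots> \<le> diam K"
    unfolding diam_def
  proof (rule Max_ge)
    show "finite {graph_dist K u v |u v. u \<in> verts K \<and> v \<in> verts K}"
      using fin by (simp add: finite_image_set2)
  qed (use uv in blast)
  finally show ?thesis .
qed

text \<open>A function that grows by at most 1 along each edge bounds distances from below. A walk
  has one edge fewer than vertices, whence the strict inequality.\<close>

lemma walk_potential:
  fixes \<delta> :: "'a \<Rightarrow> nat"
  assumes "successively (\<lambda>x y. {x, y} \<in> E) xs" "xs \<noteq> []"
    and lip: "\<And>x y. {x, y} \<in> E \<Longrightarrow> \<delta> y \<le> \<delta> x + 1"
  shows "\<delta> (last xs) < \<delta> (hd xs) + length xs"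
  using assms(1,2)
proof (induction xs rule: induct_list012)
  case (3 x y zs)
  then show ?case
    using lip[of x y] by auto
qed auto

text \<open>Two cycles with linked heads lie in one component, so they are equal as graphs and have
  the same edges. This is the uniqueness that \<open>exists_owner_avoiding\<close> asks for; at the
  top level no owner is forbidden.\<close>

lemma pseudoforest_owner:
  assumes "pseudoforest G"
  shows "\<exists>own. (\<forall>e\<in>edges G. own e \<in> e) \<and> inj_on own (edges G)"
proof -
  have G: "simple_graph G"
    and unique: "\<And>K C C'. component K G \<Longrightarrow> is_cycle C \<Longrightarrow> subgraph C K \<Longrightarrow> is_cycle C' \<Longrightarrow>
      subgraph C' K \<Longrightarrow> C = C'"
    using assms by (auto simp: pseudoforest_def)
  have "edges G \<subseteq> Pow (verts G)"
    using G by (auto simp: simple_graph_def)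
  then have fin: "finite (edges G)"
    using G by (auto simp: simple_graph_def intro: finite_subset)
  have cyc: "is_cycle (UGraph (set xs) (cycle_edges xs))"
    "subgraph (UGraph (set xs) (cycle_edges xs)) (component_of G x)"
    if xs: "cycle_in (edges G) xs" and x: "linked (edges G) x (hd xs)" "x \<in> verts G" for xs x
  proof -
    show "is_cycle (UGraph (set xs) (cycle_edges xs))"
      using xs unfolding is_cycle_def cycle_in_def cycle_edges_def by (intro exI[of _ xs]) auto
    have sub: "e \<subseteq> set xs" if "e \<in> cycle_edges xs" for e
      using that by (auto simp: cycle_edges_def intro!: nth_mem mod_less_divisor)
    have l: "linked (edges G) x y" if "y \<in> set xs" for y
      using cycle_in_linked[OF xs that] x linked_trans by metis
    then have "y \<in> verts G" if "y \<in> set xs" for y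
      using that linked_in_verts[OF _ G x(2)] by blast
    then show "subgraph (UGraph (set xs) (cycle_edges xs)) (component_of G x)"
      using l sub xs G
      by (fastforce simp: subgraph_def simple_graph_def component_of_def cycle_in_def)
  qed
  have "\<exists>own. (\<forall>e\<in>edges G. own e \<in> e - {}) \<and> inj_on own (edges G)"
  proof (rule exists_owner_avoiding[OF fin])
    show "card e = 2" if "e \<in> edges G" for e
      using that G by (auto simp: simple_graph_def)
    fix xs ys
    assume xs: "cycle_in (edges G) xs" and ys: "cycle_in (edges G) ys"
      and l: "linked (edges G) (hd xs) (hd ys)"
    have len: "length xs \<ge> 3"
      using xs by (simp add: cycle_in_def)
    then have "{xs ! 0, xs ! (Suc 0 mod length xs)} \<in> cycle_edges xs"
      unfolding cycle_edges_def by (intro CollectI exI[of _ 0]) auto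
    then have "hd xs \<in> \<Union> (edges G)"
      using xs len unfolding cycle_in_def
      by (metis UnionI hd_conv_nth insertI1 list.size(3) not_numeral_le_zero subsetD)
    then have hd: "hd xs \<in> verts G"
      using G by (auto simp: simple_graph_def)
    show "cycle_edges xs = cycle_edges ys"
      using unique[OF component_component_of[OF G hd] cyc[OF xs linked_refl hd] cyc[OF ys l hd]]
      by simp
  qed auto
  then show ?thesis
    by auto
qed

subsection \<open>The graph and its fractional arboricity\<close>

text \<open>The theorem asks for a graph on the naturals. The three kinds of vertices are built as a
  datatype and carried over by the injection \<open>to_nat\<close>.\<close>

datatype node = HubNode nat | CentreNode nat nat | BranchNode nat nat nat nat

instance node :: countable
  by countable_datatype

definition Hub :: "nat \<Rightarrow> nat" where
  "Hub s = to_nat (HubNode s)"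

definition Centre :: "nat \<Rightarrow> nat \<Rightarrow> nat" where
  "Centre t j = to_nat (CentreNode t j)"

definition Branch :: "nat \<Rightarrow> nat \<Rightarrow> nat \<Rightarrow> nat \<Rightarrow> nat" where
  "Branch t j b i = to_nat (BranchNode t j b i)"

lemma node_simps [simp]:
  "Hub s = Hub s' \<longleftrightarrow> s = s'"
  "Centre t j = Centre t' j' \<longleftrightarrow> t = t' \<and> j = j'"
  "Branch t j b i = Branch t' j' b' i' \<longleftrightarrow> t = t' \<and> j = j' \<and> b = b' \<and> i = i'"
  "Hub s \<noteq> Centre t j" "Centre t j \<noteq> Hub s"
  "Hub s \<noteq> Branch t j b i" "Branch t j b i \<noteq> Hub s"
  "Centre t j \<noteq> Branch t' j' b i" "Branch t' j' b i \<noteq> Centre t j"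
  by (auto simp: Hub_def Centre_def Branch_def)

lemma card_filter_sum: "finite A \<Longrightarrow> card {x \<in> A. P x} = (\<Sum>x\<in>A. of_bool (P x))"
  by (simp add: of_bool_def flip: sum.inter_filter)

lemma two_of_card:
  assumes "2 \<le> card A"
  obtains x y where "x \<in> A" "y \<in> A" "x \<noteq> y"
proof -
  have "\<not> A \<subseteq> {x}" for x
    using assms card_mono[of "{x}" A] by auto
  then show ?thesis
    using that by (metis assms card.empty empty_subsetI insertI1 not_numeral_le_zero subsetI
      singletonI equals0I)
qed

text \<open>There are \<open>N\<close> chains of \<open>L\<close> units each; \<open>z\<close>
  determines the length of the legs, and \<open>l\<close> is the number of pendant vertices at a
  centre.\<close>

locale chains =
  fixes k z l N L :: nat
  assumes k_ge_2: "2 \<le> k" and L_pos: "0 < L"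
begin

text \<open>Branches up to index \<open>k\<close> are the legs; a pendant vertex is treated as a
  branch of length 1.\<close>

definition len :: "nat \<Rightarrow> nat" where
  "len b = (if b \<le> k then Suc z else 1)"

definition branches :: "nat \<Rightarrow> nat" where
  "branches j = (if j = 0 then 1 else k + 1 + l)"

text \<open>Unit \<open>0\<close> consists of the extra leg only; its missing centre and the missing centre after the last
  unit are both replaced by the hub that leg \<open>0\<close> is otherwise not joined to.\<close>

definition ctr :: "nat \<Rightarrow> nat \<Rightarrow> nat" where
  "ctr t j = (if 1 \<le> j \<and> j \<le> L then Centre t j else Hub 0)"

definition parent :: "nat \<Rightarrow> nat \<Rightarrow> nat \<Rightarrow> nat \<Rightarrow> nat" where
  "parent t j b i = (if i = 0 then ctr t j else Branch t j b (i - 1))"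

definition exit :: "nat \<Rightarrow> nat \<Rightarrow> nat \<Rightarrow> nat \<Rightarrow> nat" where
  "exit t j b i = (if b = 0 \<and> i = 0 then ctr t (Suc j) else Hub 0)"

text \<open>This orients the graph: each edge is introduced at a branch vertex. A valid branch
  vertex has exactly \<open>k + 1\<close> targets, since \<open>parent\<close> and
  \<open>exit\<close> never coincide there.\<close>

definition targets :: "nat \<Rightarrow> nat \<Rightarrow> nat \<Rightarrow> nat \<Rightarrow> nat set" where
  "targets t j b i = insert (parent t j b i) (insert (exit t j b i) (Hub ` {1..<k}))"

definition valid :: "nat \<Rightarrow> nat \<Rightarrow> nat \<Rightarrow> nat \<Rightarrow> bool" where
  "valid t j b i \<longleftrightarrow> t < N \<and> j \<le> L \<and> b < branches j \<and> i < len b"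

definition V :: "nat set" where
  "V = Hub ` {..<k} \<union> (\<lambda>(t, j). Centre t j) ` ({..<N} \<times> {1..L}) \<union>
     {Branch t j b i |t j b i. valid t j b i}"

definition E :: "nat set set" where
  "E = {{Branch t j b i, y} |t j b i y. valid t j b i \<and> y \<in> targets t j b i}"

definition indices :: "(nat \<times> nat \<times> nat \<times> nat) set" where
  "indices = (SIGMA t:{..<N}. SIGMA j:{..L}. SIGMA b:{..<branches j}. {..<len b})"

lemma in_indices: "(t, j, b, i) \<in> indices \<longleftrightarrow> valid t j b i"
  by (auto simp: indices_def valid_def)

lemma finite_indices: "finite indices"
  by (auto simp: indices_def intro!: finite_SigmaI)

lemma sum_indices:
  "(\<Sum>(t, j, b, i)\<in>indices. f t j b i) =
     (\<Sum>t<N. \<Sum>j\<le>L. \<Sum>b<branches j. \<Sum>i<len b. f t j b i)"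
  unfolding indices_def by (simp add: sum.Sigma split_def)

lemma Branch_image: "{Branch t j b i |t j b i. valid t j b i} = (\<lambda>(t, j, b, i). Branch t j b i) ` indices"
  (is "?A = ?B")
proof
  show "?A \<subseteq> ?B"
    using in_indices by (auto intro!: image_eqI[of _ _ "(_, _, _, _)"])
  show "?B \<subseteq> ?A"
    by (auto simp: in_indices)
qed

lemma finite_V: "finite V"
  unfolding V_def Branch_image using finite_indices by simp

lemma ctr_in_V: "t < N \<Longrightarrow> ctr t j \<in> V"
  using k_ge_2 by (auto simp: ctr_def V_def)

lemma valid_le: "valid t j b i \<Longrightarrow> i' \<le> i \<Longrightarrow> valid t j b i'"
  by (auto simp: valid_def)

lemma targets_V: "valid t j b i \<Longrightarrow> targets t j b i \<subseteq> V"
proof -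
  assume v: "valid t j b i"
  then have "parent t j b i \<in> V"
    using ctr_in_V valid_le[OF v, of "i - 1"] by (auto simp: parent_def valid_def V_def)
  moreover have "exit t j b i \<in> V"
    using v ctr_in_V k_ge_2 by (auto simp: exit_def valid_def V_def)
  ultimately show ?thesis
    by (auto simp: targets_def V_def)
qed

lemma Branch_notin_targets: "Branch t j b i \<notin> targets t j b i"
  by (auto simp: targets_def parent_def exit_def ctr_def)

lemma simple: "simple_graph (UGraph V E)"
proof -
  have "e \<subseteq> V \<and> card e = 2" if e_in: "e \<in> E" for e
  proof -
    obtain t j b i y where e: "e = {Branch t j b i, y}" "valid t j b i" "y \<in> targets t j b i"
      using e_in by (auto simp: E_def)
    moreover have "y \<noteq> Branch t j b i"
      using e Branch_notin_targets by metis
    moreover have "Branch t j b i \<in> V"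
      using e by (auto simp: V_def)
    ultimately show ?thesis
      using targets_V[OF e(2)] by auto
  qed
  then show ?thesis
    using finite_V by (simp add: simple_graph_def)
qed

lemma card_V: "2 \<le> card V"
proof -
  have "k = card (Hub ` {..<k})"
    by (simp add: card_image inj_on_def)
  also have "\<dots> \<le> card V"
    by (rule card_mono[OF finite_V]) (auto simp: V_def)
  finally show ?thesis
    using k_ge_2 by simp
qed

lemma card_targets:
  "card (targets t j b i \<inter> W) \<le> (k - 1) + of_bool (parent t j b i \<in> W) + of_bool (exit t j b i \<in> W)"
proof -
  let ?A = "if parent t j b i \<in> W then {parent t j b i} else {}"
  let ?B = "if exit t j b i \<in> W then {exit t j b i} else {}"
  have "card (targets t j b i \<inter> W) \<le> card (Hub ` {1..<k} \<union> ?A \<union> ?B)"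
    by (rule card_mono) (auto simp: targets_def)
  also have "\<dots> \<le> card (Hub ` {1..<k}) + card ?A + card ?B"
    by (meson add_le_mono1 card_Un_le le_trans)
  also have "\<dots> = (k - 1) + of_bool (parent t j b i \<in> W) + of_bool (exit t j b i \<in> W)"
    by (simp add: card_image inj_on_def)
  finally show ?thesis .
qed

text \<open>Every edge is charged to the branch vertex that introduces it.\<close>

lemma card_edges_le:
  assumes "X \<subseteq> E" and "\<And>e. e \<in> X \<Longrightarrow> e \<subseteq> W"
  shows "card X \<le> (\<Sum>(t, j, b, i)\<in>indices.
           if Branch t j b i \<in> W then card (targets t j b i \<inter> W) else 0)"
proof -
  define Y where "Y = (\<lambda>(t, j, b, i). if Branch t j b i \<in> W
    then (\<lambda>y. {Branch t j b i, y}) ` (targets t j b i \<inter> W) else {})"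
  have fin: "finite (targets t j b i)" for t j b i
    by (simp add: targets_def)
  have "X \<subseteq> (\<Union>p\<in>indices. Y p)"
  proof
    fix e assume e: "e \<in> X"
    then obtain t j b i y where "e = {Branch t j b i, y}" "valid t j b i" "y \<in> targets t j b i"
      using assms(1) by (auto simp: E_def)
    then show "e \<in> (\<Union>p\<in>indices. Y p)"
      using assms(2)[OF e] by (intro UN_I[of "(t, j, b, i)"]) (auto simp: Y_def in_indices)
  qed
  then have "card X \<le> card (\<Union>p\<in>indices. Y p)"
    by (rule card_mono[rotated]) (auto simp: Y_def fin finite_indices)
  also have "\<dots> \<le> (\<Sum>p\<in>indices. card (Y p))"
    by (rule card_UN_le[OF finite_indices])
  also have "\<dots> \<le> (\<Sum>(t, j, b, i)\<in>indices.
           if Branch t j b i \<in> W then card (targets t j b i \<inter> W) else 0)"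
    by (rule sum_mono) (auto simp: Y_def fin intro!: card_image_le)
  finally show ?thesis .
qed

lemma card_verts:
  assumes "W \<subseteq> V"
  shows "card W = card (W \<inter> Hub ` {..<k}) + (\<Sum>t<N. \<Sum>j=1..L. of_bool (Centre t j \<in> W)) +
           (\<Sum>(t, j, b, i)\<in>indices. of_bool (Branch t j b i \<in> W))"
proof -
  let ?c = "\<lambda>(t, j). Centre t j" and ?b = "\<lambda>(t, j, b, i). Branch t j b i"
  let ?C = "?c ` {p \<in> {..<N} \<times> {1..L}. ?c p \<in> W}"
  let ?B = "?b ` {p \<in> indices. ?b p \<in> W}"
  have W: "W = (W \<inter> Hub ` {..<k}) \<union> ?C \<union> ?B"
  proof -
    have image: "f ` {p \<in> A. f p \<in> W} = f ` A \<inter> W" for f and A :: "'b set"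
      by blast
    show ?thesis
      using assms unfolding image V_def Branch_image by blast
  qed
  have fin: "finite ?C" "finite ?B"
    using finite_indices by simp_all
  have "card ((W \<inter> Hub ` {..<k}) \<union> ?C \<union> ?B) = card ((W \<inter> Hub ` {..<k}) \<union> ?C) + card ?B"
    by (rule card_Un_disjoint) (use fin in auto)
  also have "card ((W \<inter> Hub ` {..<k}) \<union> ?C) = card (W \<inter> Hub ` {..<k}) + card ?C"
    by (rule card_Un_disjoint) (use fin in auto)
  also have "card ?C = card {p \<in> {..<N} \<times> {1..L}. ?c p \<in> W}"
    by (rule card_image) (auto simp: inj_on_def)
  also have "\<dots> = (\<Sum>(t, j)\<in>{..<N} \<times> {1..L}. of_bool (Centre t j \<in> W))"
    by (subst card_filter_sum) (simp_all only: split_def finite_SigmaI finite_lessThan finite_atLeastAtMost)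
  also have "\<dots> = (\<Sum>t<N. \<Sum>j=1..L. of_bool (Centre t j \<in> W))"
    by (simp only: sum.cartesian_product)
  also have "card ?B = card {p \<in> indices. ?b p \<in> W}"
    by (rule card_image) (auto simp: inj_on_def)
  also have "\<dots> = (\<Sum>(t, j, b, i)\<in>indices. of_bool (Branch t j b i \<in> W))"
    by (subst card_filter_sum) (simp_all only: split_def finite_indices)
  finally show ?thesis
    using W by simp
qed

section \<open>Edges minus \<rho> times vertices, chain by chain\<close>

lemma sum_len: "(\<Sum>b<k + 1 + l. len b) = (k + 1) * (z + 1) + l"
proof -
  have "(\<Sum>b<k + 1 + l. len b) = (\<Sum>b<k + 1. len b) + (\<Sum>b=k + 1..<k + 1 + l. len b)"
    by (metis add_leE atLeast0LessThan le_add1 le_add_same_cancel1 sum.atLeastLessThan_concat zero_le)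
  also have "(\<Sum>b<k + 1. len b) = (\<Sum>b<k + 1. z + 1)"
    by (rule sum.cong) (auto simp: len_def)
  also have "(\<Sum>b=k + 1..<k + 1 + l. len b) = (\<Sum>b=k + 1..<k + 1 + l. 1)"
    by (rule sum.cong) (auto simp: len_def)
  finally show ?thesis
    by simp
qed

definition d :: nat where
  "d = l + z * (k + 1) + 1"

text \<open>The gain of a branch vertex all of whose \<open>k + 1\<close> targets are present: it
  adds \<open>k + 1\<close> edges and costs \<open>\<rho>\<close>.\<close>

definition \<alpha> :: real where
  "\<alpha> = (real k + 1) / (real d + real k + 1)"

definition \<rho> :: real where
  "\<rho> = real k + real d / (real d + real k + 1)"

text \<open>The second identity is the balance of a unit: the gains of its
  \<open>(k + 1) * (z + 1) + l\<close> branch vertices pay exactly for the centre, which introduces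
  no edge and costs \<open>\<rho>\<close>.\<close>

lemma rho_alpha: "\<rho> = real k + 1 - \<alpha>" and rho_alpha': "\<rho> = real ((k + 1) * (z + 1) + l) * \<alpha>"
proof -
  have pos: "real d + real k + 1 > 0"
    by simp
  show "\<rho> = real k + 1 - \<alpha>"
    using pos by (simp add: \<rho>_def \<alpha>_def field_simps)
  have "(k + 1) * (z + 1) + l = d + k"
    by (simp add: d_def algebra_simps)
  then have "real ((k + 1) * (z + 1) + l) = real d + real k"
    by (simp only: of_nat_add)
  then show "\<rho> = real ((k + 1) * (z + 1) + l) * \<alpha>"
    using pos by (simp only: \<rho>_def \<alpha>_def) (simp add: field_simps)
qed

text \<open>The bound on \<open>z\<close>, implicit in the form of \<open>d\<close>, enters here: a
  leg gains at most 1 in total, so a single missing target, which costs 1, uses up the whole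
  leg.\<close>

lemma alpha_pos: "0 < \<alpha>" and len_alpha: "len b * \<alpha> \<le> 1"
proof -
  show a: "0 < \<alpha>"
    by (simp add: \<alpha>_def add_pos_pos)
  have "Suc z * (k + 1) \<le> d + k + 1"
    by (simp add: d_def)
  then have "real (Suc z * (k + 1)) \<le> real (d + k + 1)"
    by (simp only: of_nat_le_iff)
  then have "Suc z * \<alpha> \<le> 1"
    by (simp add: \<alpha>_def field_simps)
  moreover have "len b * \<alpha> \<le> Suc z * \<alpha>"
    using a by (intro mult_right_mono) (auto simp: len_def)
  ultimately show "len b * \<alpha> \<le> 1"
    by simp
qed

lemma rho_ge: "real k \<le> \<rho>"
  unfolding \<rho>_def le_add_same_cancel1 by (intro divide_nonneg_nonneg) simp_all

context
  fixes W :: "nat set"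
begin

definition weight :: "nat \<Rightarrow> nat \<Rightarrow> nat \<Rightarrow> nat \<Rightarrow> real" where
  "weight t j b i = (if Branch t j b i \<in> W then real (card (targets t j b i \<inter> W)) - \<rho> else 0)"

definition leg :: "nat \<Rightarrow> nat \<Rightarrow> nat \<Rightarrow> real" where
  "leg t j b = (\<Sum>i<len b. weight t j b i)"

lemma weight_le: "weight t j b i \<le> \<alpha>"
proof -
  have "real (card (targets t j b i \<inter> W)) \<le> real (k + 1)"
    using card_targets[of t j b i W] k_ge_2
    by (intro of_nat_mono) (simp add: of_bool_def split: if_splits)
  then show ?thesis
    using alpha_pos by (simp add: weight_def rho_alpha)
qed

lemma weight_le':
  assumes "Branch t j b i \<in> W" and "parent t j b i \<notin> W \<or> exit t j b i \<notin> W"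
  shows "weight t j b i \<le> \<alpha> - 1"
proof -
  have "real (card (targets t j b i \<inter> W)) \<le> real k"
    using card_targets[of t j b i W] k_ge_2 assms
    by (intro of_nat_mono) (auto simp: of_bool_def split: if_splits)
  then show ?thesis
    using assms by (simp add: weight_def rho_alpha)
qed

lemma leg_le: "leg t j b \<le> len b * \<alpha>"
  unfolding leg_def using sum_bounded_above[of "{..<len b}" "weight t j b" \<alpha>] weight_le by simp

text \<open>The lowest vertex of the leg in \<open>W\<close> lacks a target: its predecessor if it
  is not the first of the leg, and otherwise \<open>ctr t j\<close> or \<open>ctr t (Suc j)\<close>.
  By \<open>len_alpha\<close> this loss cancels all gains.\<close>

lemma leg_nonpos:
  assumes "ctr t j \<notin> W \<or> b = 0 \<and> ctr t (Suc j) \<notin> W"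
  shows "leg t j b \<le> 0"
proof (cases "\<exists>i<len b. Branch t j b i \<in> W")
  case True
  define i where "i = (LEAST i. i < len b \<and> Branch t j b i \<in> W)"
  have i: "i < len b" "Branch t j b i \<in> W"
    using True unfolding i_def by (metis (mono_tags, lifting) LeastI_ex)+
  have "Branch t j b i' \<notin> W" if "i' < i" for i'
    using that i(1) not_less_Least[of i' "\<lambda>i. i < len b \<and> Branch t j b i \<in> W"] by (auto simp: i_def)
  then have "parent t j b i \<notin> W \<or> exit t j b i \<notin> W"
    using assms by (auto simp: parent_def exit_def)
  then have "weight t j b i \<le> \<alpha> - 1"
    using i weight_le' by blast
  then have "leg t j b \<le> (\<Sum>i'<len b. \<alpha> - (if i' = i then 1 else 0))"
    unfolding leg_def using weight_le by (intro sum_mono) auto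
  also have "\<dots> = len b * \<alpha> - 1"
    using i by (simp add: sum_subtractf)
  also have "\<dots> \<le> 0"
    using len_alpha by simp
  finally show ?thesis .
next
  case False
  then have "leg t j b = 0"
    unfolding leg_def by (intro sum.neutral) (auto simp: weight_def)
  then show ?thesis
    by simp
qed

definition unit_weight :: "nat \<Rightarrow> nat \<Rightarrow> real" where
  "unit_weight t j = (\<Sum>b<branches j. leg t j b) - \<rho> * of_bool (1 \<le> j \<and> ctr t j \<in> W)"

lemma unit_weight_0: "unit_weight t 0 \<le> (if ctr t 1 \<in> W then Suc z * \<alpha> else 0)"
  using leg_le[of t 0 0] leg_nonpos[of t 0 0] by (auto simp: unit_weight_def branches_def len_def)

text \<open>With its centre present a unit at best breaks even. If \<open>ctr t (Suc j)\<close> is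
  missing, leg 0 gains nothing, which leaves a deficit of one leg. Without the centre no branch
  gains.\<close>

lemma unit_weight_le:
  assumes "1 \<le> j"
  shows "unit_weight t j \<le> (if ctr t j \<in> W \<and> ctr t (Suc j) \<notin> W then - (Suc z * \<alpha>) else 0)"
proof (cases "ctr t j \<in> W")
  case True
  let ?gap = "of_bool (ctr t (Suc j) \<notin> W) * (Suc z * \<alpha>)"
  have "(\<Sum>b<branches j. leg t j b) \<le>
      (\<Sum>b<branches j. len b * \<alpha> - (if b = 0 then ?gap else 0))"
  proof (rule sum_mono)
    fix b show "leg t j b \<le> len b * \<alpha> - (if b = 0 then ?gap else 0)"
      using leg_le[of t j b] leg_nonpos[of t j b] by (auto simp: len_def)
  qed
  also have "\<dots> = real (\<Sum>b<branches j. len b) * \<alpha> - ?gap"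
    using assms
    by (simp only: sum_subtractf of_nat_sum sum_distrib_right) (simp add: branches_def)
  also have "real (\<Sum>b<branches j. len b) * \<alpha> = \<rho>"
    unfolding rho_alpha' sum_len[symmetric] using assms by (simp add: branches_def)
  finally show ?thesis
    using True assms by (auto simp: unit_weight_def)
next
  case False
  then show ?thesis
    using leg_nonpos[of t j] by (auto simp: unit_weight_def intro!: sum_nonpos)
qed

text \<open>The extra leg gains at most \<open>Suc z * \<alpha>\<close>, and only if the first
  centre is present. If some centre is missing, the unit just before the first missing one has a
  deficit of the same size.\<close>

lemma chain_weight:
  "(\<Sum>j\<le>L. unit_weight t j) \<le> (if \<forall>j\<in>{1..L}. ctr t j \<in> W then 1 else 0)"
proof -
  let ?p = "Suc z * \<alpha>"
  have p: "0 \<le> ?p" "?p \<le> 1"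
    using alpha_pos len_alpha[of 0] by (auto simp: len_def)
  show ?thesis
  proof (cases "\<forall>j\<in>{1..L}. ctr t j \<in> W")
    case True
    have "(\<Sum>j\<le>L. unit_weight t j) \<le> (\<Sum>j\<le>L. if j = 0 then ?p else 0)"
    proof (rule sum_mono)
      fix j show "unit_weight t j \<le> (if j = 0 then ?p else 0)"
        using unit_weight_0[of t] unit_weight_le[of j t] p by (auto split: if_splits)
    qed
    then show ?thesis
      using True p by simp
  next
    case False
    define m where "m = (LEAST j. 1 \<le> j \<and> j \<le> L \<and> ctr t j \<notin> W)"
    have "1 \<le> m \<and> m \<le> L \<and> ctr t m \<notin> W"
      unfolding m_def by (rule LeastI_ex) (use False in auto)
    then have m: "1 \<le> m" "m \<le> L" "ctr t m \<notin> W"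
      by auto
    have below: "ctr t j \<in> W" if "1 \<le> j" "j < m" for j
      using that m not_less_Least[of j "\<lambda>j. 1 \<le> j \<and> j \<le> L \<and> ctr t j \<notin> W"] by (auto simp: m_def)
    \<comment> \<open>For \<open>m = 1\<close> both corrections fall on unit 0, whose leg has then
      lost its exit and gains nothing.\<close>
    have "(\<Sum>j\<le>L. unit_weight t j) \<le>
        (\<Sum>j\<le>L. (if j = 0 then ?p else 0) - (if j = m - 1 then ?p else 0))"
    proof (rule sum_mono)
      fix j
      show "unit_weight t j \<le> (if j = 0 then ?p else 0) - (if j = m - 1 then ?p else 0)"
      proof (cases "j = 0")
        case True
        then show ?thesis
          using unit_weight_0[of t] m p by (cases "m = 1") (auto split: if_splits)
      next
        case j: False
        show ?thesis
        proof (cases "j = m - 1")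
          case True
          then have "Suc j = m"
            using m by simp
          then have "ctr t (Suc j) \<notin> W" "ctr t j \<in> W"
            using m below[of j] j by auto
          then show ?thesis
            using j True unit_weight_le[of j t] by simp
        next
          case False
          then show ?thesis
            using j p unit_weight_le[of j t] by (auto split: if_splits)
        qed
      qed
    qed
    also have "\<dots> = 0"
      using m(1) order_trans[OF diff_le_self m(2)] by (simp add: sum_subtractf)
    finally show ?thesis
      using False by simp
  qed
qed

text \<open>Hubs introduce no edges and appear only as a cost. Their term is kept apart because
  \<open>density\<close> uses it to pay for the -1 in the denominator.\<close>

lemma edges_minus_rho_verts:
  assumes W: "W \<subseteq> V" and X: "X \<subseteq> E" "\<And>e. e \<in> X \<Longrightarrow> e \<subseteq> W"
  shows "real (card X) - \<rho> * card W \<le>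
           (\<Sum>t<N. \<Sum>j\<le>L. unit_weight t j) - \<rho> * card (W \<inter> Hub ` {..<k})"
proof -
  let ?q = "\<lambda>t j b i. card (targets t j b i \<inter> W)"
  have "real (card X) \<le> (\<Sum>(t, j, b, i)\<in>indices. if Branch t j b i \<in> W then ?q t j b i else 0)"
    using card_edges_le[OF X] by (simp only: of_nat_le_iff)
  also have "\<dots> = (\<Sum>(t, j, b, i)\<in>indices. if Branch t j b i \<in> W then real (?q t j b i) else 0)"
    unfolding of_nat_sum by (intro sum.cong) auto
  finally have "real (card X) - \<rho> * (\<Sum>(t, j, b, i)\<in>indices. of_bool (Branch t j b i \<in> W)) \<le>
      (\<Sum>(t, j, b, i)\<in>indices. if Branch t j b i \<in> W then real (?q t j b i) else 0) -
      (\<Sum>(t, j, b, i)\<in>indices. \<rho> * of_bool (Branch t j b i \<in> W))"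
    by (simp add: sum_distrib_left split_def)
  also have "\<dots> = (\<Sum>(t, j, b, i)\<in>indices. weight t j b i)"
    unfolding sum_subtractf[symmetric] by (intro sum.cong) (auto simp: weight_def)
  also have "\<dots> = (\<Sum>t<N. \<Sum>j\<le>L. \<Sum>b<branches j. leg t j b)"
    by (simp add: sum_indices leg_def)
  finally have 1: "real (card X) - \<rho> * (\<Sum>(t, j, b, i)\<in>indices. of_bool (Branch t j b i \<in> W)) \<le>
      (\<Sum>t<N. \<Sum>j\<le>L. \<Sum>b<branches j. leg t j b)" .
  have "(\<Sum>j\<le>L. of_bool (1 \<le> j \<and> ctr t j \<in> W)) = (\<Sum>j=1..L. of_bool (Centre t j \<in> W) :: real)" for t
    by (rule sum.mono_neutral_cong_right) (auto simp: ctr_def)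
  then have 2: "(\<Sum>t<N. \<Sum>j\<le>L. unit_weight t j) = (\<Sum>t<N. \<Sum>j\<le>L. \<Sum>b<branches j. leg t j b) -
      \<rho> * (\<Sum>t<N. \<Sum>j=1..L. of_bool (Centre t j \<in> W))"
    by (simp add: unit_weight_def sum_subtractf flip: sum_distrib_left)
  have "real (card W) = real (card (W \<inter> Hub ` {..<k})) +
      (\<Sum>t<N. \<Sum>j=1..L. of_bool (Centre t j \<in> W) :: real) +
      (\<Sum>(t, j, b, i)\<in>indices. of_bool (Branch t j b i \<in> W) :: real)"
    unfolding card_verts[OF W] by (simp only: of_nat_add of_nat_sum of_nat_of_bool split_def)
  then have "\<rho> * card W = \<rho> * card (W \<inter> Hub ` {..<k}) +
      \<rho> * (\<Sum>t<N. \<Sum>j=1..L. of_bool (Centre t j \<in> W)) +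
      \<rho> * (\<Sum>(t, j, b, i)\<in>indices. of_bool (Branch t j b i \<in> W))"
    by (metis (no_types, lifting) distrib_left)
  then show ?thesis
    using 1 2 by linarith
qed

text \<open>Here no hub pays for the -1 in the denominator, so edges are counted directly. Each
  branch vertex keeps at most the two targets \<open>parent\<close> and \<open>exit\<close>, and
  \<open>2 \<le> k\<close>. A centre in \<open>W\<close> introduces no edge; if there is none, each
  vertex introduces at most one edge, and the lowest one of some leg introduces none.\<close>

lemma edges_without_hubs:
  assumes W: "W \<subseteq> V" "W \<noteq> {}" "W \<inter> Hub ` {..<k} = {}"
    and X: "X \<subseteq> E" "\<And>e. e \<in> X \<Longrightarrow> e \<subseteq> W"
  shows "card X \<le> k * (card W - 1)"
proof -
  define I where "I = {(t, j, b, i) \<in> indices. Branch t j b i \<in> W}"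
  let ?q = "\<lambda>(t, j, b, i). card (targets t j b i \<inter> W)"
  have finI: "finite I"
    using finite_indices by (auto simp: I_def intro: finite_subset)
  have finW: "finite W"
    using W finite_V finite_subset by blast
  have hubs: "Hub s \<notin> W" if "s < k" for s
    using W that by auto
  have inj: "inj_on (\<lambda>(t, j, b, i). Branch t j b i) I"
    by (auto simp: inj_on_def)
  have sub: "(\<lambda>(t, j, b, i). Branch t j b i) ` I \<subseteq> W"
    by (auto simp: I_def)
  have cardI: "card I \<le> card W"
    using card_image[OF inj] card_mono[OF finW sub] by simp
  note card_edges_le[OF X]
  also have "(\<Sum>(t, j, b, i)\<in>indices. if Branch t j b i \<in> W then card (targets t j b i \<inter> W) else 0) =
      (\<Sum>p\<in>I. ?q p)"
    unfolding I_def using finite_indices by (intro sum.mono_neutral_cong_right) (auto split: if_splits)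
  finally have X_le: "card X \<le> (\<Sum>p\<in>I. ?q p)" .
  have "targets t j b i \<inter> W \<subseteq> {parent t j b i, exit t j b i}" for t j b i
    using hubs by (auto simp: targets_def)
  then have "card (targets t j b i \<inter> W) \<le> card {parent t j b i, exit t j b i}" for t j b i
    by (intro card_mono) auto
  also have "card {parent t j b i, exit t j b i} \<le> 2" for t j b i
    by (simp add: card_insert_if)
  finally have q2: "?q p \<le> 2" for p
    by (simp add: split_def)
  show ?thesis
  proof (cases "\<exists>c\<in>W. c \<notin> (\<lambda>(t, j, b, i). Branch t j b i) ` I")
    case True
    then have "card ((\<lambda>(t, j, b, i). Branch t j b i) ` I) < card W"
      using sub finW by (intro psubset_card_mono) auto
    then have "card I \<le> card W - 1"
      using card_image[OF inj] by simp
    then have "(\<Sum>p\<in>I. ?q p) \<le> 2 * (card W - 1)"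
      using sum_bounded_above[of I ?q 2] q2 by fastforce
    also have "\<dots> \<le> k * (card W - 1)"
      using k_ge_2 by simp
    finally show ?thesis
      using X_le by simp
  next
    case False
    have ctr: "ctr t j \<notin> W" for t j
      using False hubs[of 0] k_ge_2 by (auto simp: ctr_def)
    have "targets t j b i \<inter> W \<subseteq> (if i \<noteq> 0 \<and> Branch t j b (i - 1) \<in> W then {Branch t j b (i - 1)} else {})"
      for t j b i
      using hubs k_ge_2 ctr by (auto simp: targets_def parent_def exit_def)
    then have "?q (t, j, b, i) \<le>
        card (if i \<noteq> 0 \<and> Branch t j b (i - 1) \<in> W then {Branch t j b (i - 1)} else {})" for t j b i
      unfolding prod.case by (intro card_mono) auto
    then have q1: "?q (t, j, b, i) \<le> of_bool (i \<noteq> 0 \<and> Branch t j b (i - 1) \<in> W)" for t j b i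
      by (rule order_trans) simp
    then have "?q (t, j, b, i) \<le> 1" for t j b i
      by (rule order_trans) simp
    then have q1': "?q p \<le> 1" for p
      by (cases p) blast
    have "I \<noteq> {}"
      using False W(2) by auto
    then obtain t j b i where p: "(t, j, b, i) \<in> I"
      by fast
    define m where "m = (LEAST i. Branch t j b i \<in> W)"
    have m: "Branch t j b m \<in> W" "m \<le> i"
      using p unfolding m_def I_def by (auto intro: LeastI Least_le)
    have mI: "(t, j, b, m) \<in> I"
      using p m valid_le[of t j b i m] by (auto simp: I_def in_indices)
    have "m = 0 \<or> Branch t j b (m - 1) \<notin> W"
      using not_less_Least[of "m - 1" "\<lambda>i. Branch t j b i \<in> W"] by (auto simp: m_def)
    then have "?q (t, j, b, m) = 0"
      using q1[of t j b m] by auto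
    then have "(\<Sum>p\<in>I. ?q p) = (\<Sum>p\<in>I - {(t, j, b, m)}. ?q p)"
      using sum.remove[OF finI mI, of ?q] by simp
    also have "\<dots> \<le> card (I - {(t, j, b, m)})"
      using sum_bounded_above[of "I - {(t, j, b, m)}" ?q 1] q1' by simp
    also have "\<dots> \<le> card W - 1"
      using cardI mI by (simp add: finI)
    also have "\<dots> \<le> k * (card W - 1)"
      using k_ge_2 by simp
    finally show ?thesis
      using X_le by simp
  qed
qed

end

lemma density:
  fixes \<epsilon> :: real
  assumes W: "W \<subseteq> V" "2 \<le> card W" and X: "X \<subseteq> E" "\<And>e. e \<in> X \<Longrightarrow> e \<subseteq> W"
    and \<epsilon>: "0 < \<epsilon>" "real N < \<epsilon> * L"
  shows "real (card X) / (real (card W) - 1) < \<rho> + \<epsilon>"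
proof -
  have finW: "finite W"
    using W finite_V finite_subset by blast
  have pos: "real (card W) - 1 > 0"
    using W by simp
  have "real (card X) < (\<rho> + \<epsilon>) * (real (card W) - 1)"
  proof (cases "W \<inter> Hub ` {..<k} = {}")
    case True
    have "card X \<le> k * (card W - 1)"
      by (rule edges_without_hubs[OF W(1) _ True X]) (use W in auto)
    then have "real (card X) \<le> real (k * (card W - 1))"
      by (simp only: of_nat_le_iff)
    also have "\<dots> = real k * (real (card W) - 1)"
      using W by (simp add: of_nat_diff)
    also have "\<dots> < (\<rho> + \<epsilon>) * (real (card W) - 1)"
      using rho_ge \<epsilon> pos by (intro mult_strict_right_mono) auto
    finally show ?thesis .
  next
    case False
    then have "1 \<le> card (W \<inter> Hub ` {..<k})"
      by (simp add: Suc_le_eq card_gt_0_iff)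
    then have "\<rho> * 1 \<le> \<rho> * card (W \<inter> Hub ` {..<k})"
      using rho_ge k_ge_2 by (intro mult_left_mono) auto
    then have X_le: "real (card X) \<le> \<rho> * (real (card W) - 1) + (\<Sum>t<N. \<Sum>j\<le>L. unit_weight W t j)"
      using edges_minus_rho_verts[OF W(1) X] by (simp add: algebra_simps)
    also have "(\<Sum>t<N. \<Sum>j\<le>L. unit_weight W t j) < \<epsilon> * (real (card W) - 1)"
    proof (cases "\<exists>t<N. \<forall>j\<in>{1..L}. ctr t j \<in> W")
      case True
      then obtain t where t: "\<And>j. j \<in> {1..L} \<Longrightarrow> ctr t j \<in> W"
        by blast
      obtain s where s: "s < k" "Hub s \<in> W"
        using False by auto
      \<comment> \<open>The \<open>L\<close> centres and one hub give
        \<open>L \<le> card W - 1\<close>, which absorbs a surplus of at most 1 from each of the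
        \<open>N\<close> chains.\<close>
      have "Suc L = card (insert (Hub s) (Centre t ` {1..L}))"
        by (subst card_insert_disjoint) (auto simp: card_image inj_on_def)
      also have "\<dots> \<le> card W"
        using t s by (intro card_mono finW) (auto simp: ctr_def)
      finally have "\<epsilon> * L \<le> \<epsilon> * (real (card W) - 1)"
        using \<epsilon> by (intro mult_left_mono) auto
      have "(\<Sum>t<N. \<Sum>j\<le>L. unit_weight W t j) \<le> (\<Sum>t<N. 1)"
        by (intro sum_mono order_trans[OF chain_weight]) simp
      also have "\<dots> < \<epsilon> * L"
        using \<epsilon> by simp
      also note \<open>\<epsilon> * L \<le> \<epsilon> * (real (card W) - 1)\<close>
      finally show ?thesis .
    next
      case False
      then have "(\<Sum>t<N. \<Sum>j\<le>L. unit_weight W t j) \<le> 0"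
        by (intro sum_nonpos order_trans[OF chain_weight]) auto
      also have "0 < \<epsilon> * (real (card W) - 1)"
        using \<epsilon> pos by simp
      finally show ?thesis .
    qed
    finally show ?thesis
      by (simp add: algebra_simps)
  qed
  then show ?thesis
    using pos by (simp add: pos_divide_less_eq)
qed

lemma fractional_arboricity_less:
  fixes \<epsilon> :: real
  assumes \<epsilon>: "0 < \<epsilon>" "real N < \<epsilon> * L"
  shows "fractional_arboricity (UGraph V E) < \<rho> + \<epsilon>"
proof -
  let ?q = "\<lambda>H. real (card (edges H)) / (real (card (verts H)) - 1)"
  let ?S = "{?q H |H. subgraph H (UGraph V E) \<and> card (verts H) \<ge> 2}"
  have "E \<subseteq> Pow V"
    using simple by (auto simp: simple_graph_def)
  then have "finite E"
    using finite_V finite_subset by blast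
  then have "finite ((\<lambda>(A, B). UGraph A B) ` (Pow V \<times> Pow E))"
    using finite_V by simp
  moreover have "{H. subgraph H (UGraph V E) \<and> card (verts H) \<ge> 2} \<subseteq>
      (\<lambda>(A, B). UGraph A B) ` (Pow V \<times> Pow E)"
  proof
    fix H assume "H \<in> {H. subgraph H (UGraph V E) \<and> card (verts H) \<ge> 2}"
    then show "H \<in> (\<lambda>(A, B). UGraph A B) ` (Pow V \<times> Pow E)"
      by (intro image_eqI[of _ _ "(verts H, edges H)"]) (auto simp: subgraph_def)
  qed
  ultimately have "finite {H. subgraph H (UGraph V E) \<and> card (verts H) \<ge> 2}"
    by (rule finite_subset[rotated])
  then have fin: "finite ?S"
    by (simp add: setcompr_eq_image)
  have "subgraph (UGraph V E) (UGraph V E)"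
    using simple by (simp add: subgraph_def)
  then have "?q (UGraph V E) \<in> ?S"
    using card_V by (intro CollectI exI[of _ "UGraph V E"]) simp
  then have ne: "?S \<noteq> {}"
    by blast
  have "x < \<rho> + \<epsilon>" if "x \<in> ?S" for x
  proof -
    obtain H where H: "x = ?q H" "subgraph H (UGraph V E)" "card (verts H) \<ge> 2"
      using \<open>x \<in> ?S\<close> by blast
    show ?thesis
      unfolding H(1)
      by (rule density[OF _ H(3) _ _ \<epsilon>]) (use H(2) in \<open>auto simp: subgraph_def simple_graph_def\<close>)
  qed
  then show ?thesis
    unfolding fractional_arboricity_def Max_less_iff[OF fin ne] by (rule ballI)
qed

end

subsection \<open>Decompositions of the graph\<close>

context chains
begin

lemma finite_E: "finite E"
proof -
  have "E \<subseteq> Pow V"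
    using simple by (auto simp: simple_graph_def)
  then show ?thesis
    using finite_V finite_subset by blast
qed

lemma E_cases:
  assumes "e \<in> E"
  obtains t j b i y where "e = {Branch t j b i, y}" "valid t j b i" "y \<in> targets t j b i"
  using assms by (auto simp: E_def)

lemma E_I: "valid t j b i \<Longrightarrow> y \<in> targets t j b i \<Longrightarrow> {Branch t j b i, y} \<in> E"
  unfolding E_def by blast

end

text \<open>Of the decomposition only the edges \<open>F\<close> of one part and owners of the other
  edges are kept. In chain \<open>t\<close> every edge to a hub lies outside \<open>F\<close> and is
  owned by its branch vertex.\<close>

locale clean_chain = chains +
  fixes F :: "nat set set" and own :: "nat set \<Rightarrow> nat" and t :: nat
  assumes F_sub: "F \<subseteq> E"
    and own_in: "e \<in> E - F \<Longrightarrow> own e \<in> e"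
    and own_card: "card {e \<in> E - F. own e = x} \<le> k"
    and t_less: "t < N"
    and clean: "valid t j b i \<Longrightarrow> Hub s \<in> targets t j b i \<Longrightarrow>
      {Branch t j b i, Hub s} \<notin> F \<and> own {Branch t j b i, Hub s} \<noteq> Hub s"
begin

abbreviation B :: "nat \<Rightarrow> nat \<Rightarrow> nat \<Rightarrow> nat" where
  "B \<equiv> Branch t"

definition up :: "nat \<Rightarrow> nat \<Rightarrow> nat \<Rightarrow> nat set" where
  "up j b i = {B j b i, parent t j b i}"

definition link :: "nat \<Rightarrow> nat set" where
  "link j = {B j 0 0, ctr t (Suc j)}"

text \<open>These are the valid branch vertices joined to all \<open>k\<close> hubs. The exceptions,
  the first vertices of leg 0 in units 1 to \<open>L - 1\<close>, are joined to two centres.\<close>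

definition full :: "nat \<Rightarrow> nat \<Rightarrow> nat \<Rightarrow> bool" where
  "full j b i \<longleftrightarrow> b \<noteq> 0 \<or> i \<noteq> 0 \<or> j = 0 \<or> j = L"

definition tip :: "nat \<Rightarrow> nat \<Rightarrow> bool" where
  "tip m b \<longleftrightarrow> b \<le> k \<and> valid t m b z"

definition attached :: "nat \<Rightarrow> nat set set \<Rightarrow> bool" where
  "attached r X \<longleftrightarrow> X \<subseteq> F \<and> (\<forall>e\<in>X. \<forall>y\<in>e. linked F r y)"

text \<open>The goal in terms of tips: \<open>2 * (z + 1) + l\<close> equals
  \<open>d - z * (k - 1) + 1\<close>, and distinct tips joined in \<open>F\<close> turn out to have
  distance at least \<open>2 * (z + 1)\<close>.\<close>

definition long_and_large :: bool where
  "long_and_large \<longleftrightarrow> (\<exists>r X m b m' b'. attached r X \<and> 2 * (z + 1) + l \<le> card X \<and>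
     tip m b \<and> tip m' b' \<and> (m, b) \<noteq> (m', b') \<and> linked F r (B m b z) \<and> linked F r (B m' b' z))"

definition from_unit :: "nat \<Rightarrow> nat set set" where
  "from_unit j = {e. \<exists>j' b i. j \<le> j' \<and> B j' b i \<in> e}"

text \<open>The restriction to \<open>from_unit j\<close> keeps these edges apart from those of
  earlier units, which are added later.\<close>

definition anchored :: "nat \<Rightarrow> bool" where
  "anchored j \<longleftrightarrow> (\<exists>X m b. attached (ctr t j) X \<and> X \<subseteq> from_unit j \<and> z + 1 + l \<le> card X \<and>
     j \<le> m \<and> tip m b \<and> linked F (ctr t j) (B m b z))"

text \<open>The invariant passed from each unit to the preceding one. Its second part forces a link
  outside \<open>F\<close> to be owned by the branch vertex at its other end.\<close>

definition safe :: "nat \<Rightarrow> bool" where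
  "safe j \<longleftrightarrow> anchored j \<and> (link (j - 1) \<in> F \<or> own (link (j - 1)) \<noteq> ctr t j)"

lemma valid_0: "j \<le> L \<Longrightarrow> valid t j 0 i \<longleftrightarrow> i \<le> z"
  using t_less by (auto simp: valid_def branches_def len_def)

lemma up_E: "valid t j b i \<Longrightarrow> up j b i \<in> E"
  unfolding up_def by (rule E_I) (auto simp: targets_def)

lemma link_E: "j \<le> L \<Longrightarrow> link j \<in> E"
  unfolding link_def by (rule E_I) (auto simp: targets_def exit_def valid_0)

lemma edge_branch:
  assumes "e \<in> E" "B j b i \<in> e" "B j' b' i' \<in> e"
  shows "j = j' \<and> b = b'"
  using assms by (elim E_cases) (auto simp: targets_def parent_def exit_def ctr_def split: if_splits)

section \<open>What a branch vertex can own besides its edges to hubs\<close>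

lemma own_hub:
  assumes "valid t j b i" "Hub s \<in> targets t j b i"
  shows "{B j b i, Hub s} \<in> E - F" "own {B j b i, Hub s} = B j b i"
proof -
  show *: "{B j b i, Hub s} \<in> E - F"
    using E_I[OF assms] clean[OF assms] by simp
  show "own {B j b i, Hub s} = B j b i"
    using own_in[OF *] clean[OF assms] by auto
qed

lemma slots:
  assumes v: "valid t j b i" and S: "finite S" "Hub ` S \<subseteq> targets t j b i"
    and X: "X \<subseteq> {e \<in> E - F. own e = B j b i}" "\<And>e s. e \<in> X \<Longrightarrow> Hub s \<notin> e"
  shows "card X + card S \<le> k"
proof -
  let ?h = "\<lambda>s. {B j b i, Hub s}"
  have finX: "finite X"
    using X(1) finite_E by (auto intro: finite_subset)
  have "?h ` S \<subseteq> {e \<in> E - F. own e = B j b i}"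
    using own_hub[OF v] S(2) by auto
  then have "card (X \<union> ?h ` S) \<le> card {e \<in> E - F. own e = B j b i}"
    using X(1) finite_E by (intro card_mono) auto
  also have "\<dots> \<le> k"
    by (rule own_card)
  also have "card (X \<union> ?h ` S) = card X + card (?h ` S)"
    using X(2) S(1) finX by (intro card_Un_disjoint) auto
  also have "card (?h ` S) = card S"
    by (rule card_image) (auto simp: inj_on_def doubleton_eq_iff)
  finally show ?thesis .
qed

lemma full_own:
  assumes "valid t j b i" "full j b i" "e \<in> E - F" "\<And>s. Hub s \<notin> e"
  shows "own e \<noteq> B j b i"
proof
  assume "own e = B j b i"
  moreover have "Hub 0 \<in> targets t j b i"
    using assms(2) by (auto simp: full_def targets_def parent_def exit_def ctr_def)
  then have "Hub s \<in> targets t j b i" if "s < k" for s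
    using that by (cases "s = 0") (auto simp: targets_def)
  then have "Hub ` {..<k} \<subseteq> targets t j b i"
    by auto
  ultimately have "card {e} + card {..<k} \<le> k"
    using assms by (intro slots[OF assms(1)]) auto
  then show False
    by simp
qed

text \<open>Meant for the first vertex of leg 0: the hubs 1 to \<open>k - 1\<close> take all but one
  of the \<open>k\<close> edges that it may own.\<close>

lemma link_own:
  assumes "valid t j b i" "e \<in> E - F" "e' \<in> E - F" "\<And>s. Hub s \<notin> e" "\<And>s. Hub s \<notin> e'"
    "own e = B j b i" "own e' = B j b i"
  shows "e = e'"
proof -
  have "card {e, e'} + card {1..<k} \<le> k"
    using assms by (intro slots[OF assms(1)]) (auto simp: targets_def)
  then show ?thesis
    using k_ge_2 by (auto simp: card_insert_if split: if_splits)
qed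

lemma up_no_hub: "0 < i \<or> 1 \<le> j \<and> j \<le> L \<Longrightarrow> Hub s \<notin> up j b i"
  by (auto simp: up_def parent_def ctr_def)

lemma link_no_hub: "j < L \<Longrightarrow> Hub s \<notin> link j"
  by (auto simp: link_def ctr_def)

text \<open>Both ends of the edge are full, so outside \<open>F\<close> it would have no
  owner.\<close>

lemma up_in_F:
  assumes v: "valid t j b i" and i: "2 \<le> i \<or> 1 \<le> i \<and> full j b 0"
  shows "up j b i \<in> F"
proof (rule ccontr)
  assume "up j b i \<notin> F"
  then have e: "up j b i \<in> E - F"
    using up_E[OF v] by simp
  have "own (up j b i) \<noteq> B j b i"
    using i by (intro full_own[OF v _ e] up_no_hub) (auto simp: full_def)
  moreover have "own (up j b i) \<noteq> B j b (i - 1)"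
    using i by (intro full_own[OF valid_le[OF v] _ e] up_no_hub) (auto simp: full_def)
  ultimately show False
    using own_in[OF e] i by (auto simp: up_def parent_def)
qed

section \<open>Growing a component of F along the chain\<close>

lemma tail_linked:
  assumes "\<And>i'. 0 < i' \<Longrightarrow> i' \<le> i \<Longrightarrow> up j b i' \<in> F"
  shows "linked F (B j b 0) (B j b i)"
  using assms
proof (induction i)
  case (Suc i)
  have "{B j b i, B j b (Suc i)} \<in> F"
    using Suc.prems[of "Suc i"] by (simp add: up_def parent_def insert_commute)
  moreover have "linked F (B j b 0) (B j b i)"
    by (rule Suc.IH) (use Suc.prems in simp)
  ultimately show ?case
    by (meson linked_edge linked_trans)
qed simp

lemma inj_up: "inj_on (up j b) A"
  by (auto simp: inj_on_def up_def parent_def doubleton_eq_iff ctr_def split: if_splits)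

text \<open>The link and the \<open>z\<close> inner edges of an intact leg add \<open>z + 1\<close>
  edges and a second tip to what \<open>anchored\<close> provides.\<close>

lemma push:
  assumes j: "j < L" and anch: "anchored (Suc j)" and link: "link j \<in> F"
    and tail: "\<And>i. 0 < i \<Longrightarrow> i \<le> z \<Longrightarrow> up j 0 i \<in> F"
  shows long_and_large
proof -
  obtain X m b where X: "attached (ctr t (Suc j)) X" "X \<subseteq> from_unit (Suc j)" "z + 1 + l \<le> card X"
    and m: "Suc j \<le> m" "tip m b" "linked F (ctr t (Suc j)) (B m b z)"
    using anch by (auto simp: anchored_def)
  let ?Y = "insert (link j) (up j 0 ` {1..z})"
  have l0: "linked F (ctr t (Suc j)) (B j 0 0)"
    using link linked_edge[of "ctr t (Suc j)" "B j 0 0"] by (simp add: link_def insert_commute)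
  have li: "linked F (ctr t (Suc j)) (B j 0 i)" if "i \<le> z" for i
    using l0 tail_linked[of i j 0] tail that by (meson le_trans linked_trans)
  have Y: "attached (ctr t (Suc j)) ?Y"
    using link tail li l0 by (auto simp: attached_def link_def up_def parent_def)
  have "link j \<notin> up j 0 ` {1..z}"
    using j by (auto simp: link_def up_def parent_def ctr_def doubleton_eq_iff)
  then have "card ?Y = z + 1"
    by (simp add: card_image inj_up)
  have "X \<inter> ?Y = {}"
  proof -
    have "e \<notin> from_unit (Suc j)" if "e \<in> ?Y" for e
    proof
      assume "e \<in> from_unit (Suc j)"
      then obtain j' b i where *: "Suc j \<le> j'" "B j' b i \<in> e"
        by (auto simp: from_unit_def)
      have "e \<in> E" "\<exists>i. B j 0 i \<in> e"
        using that Y F_sub by (auto simp: attached_def link_def up_def)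
      then show False
        using edge_branch * by fastforce
    qed
    then show ?thesis
      using X(2) by auto
  qed
  moreover have "finite X"
    using X(1) F_sub finite_E by (auto simp: attached_def intro: finite_subset)
  ultimately have "card (X \<union> ?Y) = card X + card ?Y"
    by (intro card_Un_disjoint) auto
  then have "2 * (z + 1) + l \<le> card (X \<union> ?Y)"
    using X(3) \<open>card ?Y = z + 1\<close> by simp
  moreover have "attached (ctr t (Suc j)) (X \<union> ?Y)"
    using X(1) Y by (auto simp: attached_def)
  moreover have "tip j 0"
    using j by (simp add: tip_def valid_0)
  moreover have "(j, 0) \<noteq> (m, b)"
    using m by auto
  ultimately show ?thesis
    using m li[of z] unfolding long_and_large_def by blast
qed

text \<open>Later units are assigned to leg 0, through whose link they are reached; edges counted
  for different branches are then distinct.\<close>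

definition region :: "nat \<Rightarrow> nat \<Rightarrow> nat set set" where
  "region j b = {e. (\<exists>i. B j b i \<in> e) \<or> b = 0 \<and> e \<in> from_unit (Suc j)}"

lemma region_disjoint: "e \<in> E \<Longrightarrow> e \<in> region j b \<Longrightarrow> e \<in> region j b' \<Longrightarrow> b = b'"
  unfolding region_def from_unit_def using edge_branch by fastforce

lemma region_from_unit: "region j b \<subseteq> from_unit j"
  unfolding region_def from_unit_def by auto (metis Suc_leD)

text \<open>For leg 0 the edges and the tip may come from later units instead of the leg
  itself.\<close>

definition hanging :: "nat \<Rightarrow> nat \<Rightarrow> nat set set \<Rightarrow> bool" where
  "hanging j b X \<longleftrightarrow> attached (ctr t j) X \<and> len b \<le> card X \<and> X \<subseteq> region j b \<and>
     (b \<le> k \<longrightarrow> (\<exists>m b'. tip m b' \<and> linked F (ctr t j) (B m b' z) \<and>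
        ((m, b') = (j, b) \<or> b = 0 \<and> j < m)))"

lemma hanging_intact:
  assumes v: "valid t j b 0" and up0: "up j b 0 \<in> F"
    and tail: "\<And>i. 0 < i \<Longrightarrow> i < len b \<Longrightarrow> up j b i \<in> F"
  shows "hanging j b (up j b ` {..<len b})"
proof -
  have l0: "linked F (ctr t j) (B j b 0)"
    using up0 linked_edge[of "ctr t j" "B j b 0"] by (simp add: up_def parent_def insert_commute)
  have li: "linked F (ctr t j) (B j b i)" if "i < len b" for i
    using l0 tail_linked[of i j b] tail that by (meson le_less_trans linked_trans)
  have F: "up j b i \<in> F" if "i < len b" for i
    using that up0 tail by (cases "i = 0") auto
  have "attached (ctr t j) (up j b ` {..<len b})"
    using li F by (auto simp: attached_def up_def parent_def)
  moreover have "card (up j b ` {..<len b}) = len b"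
    by (simp add: card_image inj_up)
  moreover have "up j b ` {..<len b} \<subseteq> region j b"
    by (auto simp: region_def up_def)
  moreover have "tip j b \<and> linked F (ctr t j) (B j b z)" if "b \<le> k"
    using v that li[of z] by (auto simp: tip_def valid_def len_def)
  ultimately show ?thesis
    by (auto simp: hanging_def)
qed

text \<open>If all vertices of a branch are full, its inner edges are in \<open>F\<close>, and its
  top edge is in \<open>F\<close> or owned by the centre. Otherwise the branch is leg 0, whose first
  vertex can own one more edge. If the link is outside \<open>F\<close>, it is that edge by
  \<open>safe\<close>, and the leg behaves like the others. If the link is in \<open>F\<close>, then
  by \<open>push\<close> some inner edge is not, and it can only be the one to the second vertex. So
  the top edge is owned by the centre or in \<open>F\<close>, and in the latter case the component
  of the next centre replaces the leg.\<close>

lemma hang: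
  assumes j: "1 \<le> j" "j \<le> L" and next_safe: "j < L \<Longrightarrow> safe (Suc j)"
    and not_good: "\<not> long_and_large" and b: "b < branches j"
  shows "up j b 0 \<in> F \<and> (\<exists>X. hanging j b X) \<or> up j b 0 \<in> E - F \<and> own (up j b 0) = ctr t j"
proof -
  have v: "valid t j b i" if "i < len b" for i
    using that j b t_less by (simp add: valid_def)
  have v0: "valid t j b 0"
    by (rule v) (simp add: len_def)
  have intact: ?thesis
    if tail: "\<And>i. 0 < i \<Longrightarrow> i < len b \<Longrightarrow> up j b i \<in> F"
      and "up j b 0 \<notin> F \<Longrightarrow> own (up j b 0) \<noteq> B j b 0"
  proof (cases "up j b 0 \<in> F")
    case True
    then show ?thesis
      using hanging_intact[OF v0 True tail] by blast
  next
    case False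
    then have "up j b 0 \<in> E - F"
      using up_E[OF v0] by simp
    moreover from this have "own (up j b 0) = ctr t j"
      using own_in that(2)[OF False] by (auto simp: up_def parent_def)
    ultimately show ?thesis
      by blast
  qed
  show ?thesis
  proof (cases "full j b 0")
    case True
    show ?thesis
    proof (rule intact)
      show "up j b i \<in> F" if "0 < i" "i < len b" for i
        using up_in_F[OF v[OF that(2)]] that True by simp
      show "own (up j b 0) \<noteq> B j b 0" if "up j b 0 \<notin> F"
        using full_own[OF v0 True] up_E[OF v0] that up_no_hub j by simp
    qed
  next
    case False
    then have b0: "b = 0" and jL: "j < L"
      using j by (auto simp: full_def)
    have safe: "anchored (Suc j)" "link j \<in> F \<or> own (link j) \<noteq> ctr t (Suc j)"
      using next_safe[OF jL] by (auto simp: safe_def)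
    have tail2: "up j 0 i \<in> F" if "2 \<le> i" "i \<le> z" for i
      using up_in_F[of j 0 i] that jL by (simp add: valid_0)
    have len0: "len b = Suc z"
      using b0 by (simp add: len_def)
    show ?thesis
    proof (cases "link j \<in> F")
      case False
      then have link: "link j \<in> E - F" "own (link j) = B j 0 0"
        using link_E[of j] jL own_in[of "link j"] safe(2) by (auto simp: link_def)
      have other: "own (up j 0 i) \<noteq> B j 0 0" if "i \<le> z" "up j 0 i \<notin> F" for i
      proof
        assume own: "own (up j 0 i) = B j 0 0"
        have "up j 0 i = link j"
        proof (rule link_own)
          show "valid t j 0 0" "up j 0 i \<in> E - F"
            using v0 b0 up_E[of j 0 i] that jL by (auto simp: valid_0)
          show "Hub s \<notin> up j 0 i" "Hub s \<notin> link j" for s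
            using up_no_hub link_no_hub jL j by auto
        qed (use own link in auto)
        then show False
          using jL j by (auto simp: up_def link_def parent_def ctr_def doubleton_eq_iff split: if_splits)
      qed
      show ?thesis
      proof (rule intact)
        fix i assume i: "0 < i" "i < len b"
        show "up j b i \<in> F"
        proof (cases "i = 1")
          case True
          show ?thesis
          proof (rule ccontr)
            assume notF: "up j b i \<notin> F"
            then have e: "up j b 1 \<in> E - F"
              using up_E[OF v[OF i(2)]] True by simp
            have "own (up j b 1) \<noteq> B j b 1"
              using i True v full_own[OF _ _ e] up_no_hub by (simp add: full_def)
            moreover have "own (up j b 1) \<noteq> B j b 0"
              using other[of 1] e b0 i True len0 by simp
            ultimately show False
              using own_in[OF e] by (auto simp: up_def parent_def)
          qed
        qed (use tail2 i b0 len0 in auto)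
      qed (use other[of 0] b0 in auto)
    next
      case True
      have "\<not> (\<forall>i. 0 < i \<longrightarrow> i \<le> z \<longrightarrow> up j 0 i \<in> F)"
        using push[OF jL safe(1) True] not_good by blast
      then obtain i where i: "0 < i" "i \<le> z" "up j 0 i \<notin> F"
        by blast
      then have "i = 1"
        using tail2[of i] by (cases "i = 1") auto
      then have v1: "valid t j 0 1" and e1: "up j 0 1 \<in> E - F"
        using i jL up_E[of j 0 1] by (auto simp: valid_0)
      have "own (up j 0 1) \<noteq> B j 0 1"
        by (rule full_own[OF v1 _ e1]) (auto simp: full_def up_no_hub)
      then have own1: "own (up j 0 1) = B j 0 0"
        using own_in[OF e1] by (auto simp: up_def parent_def)
      show ?thesis
      proof (cases "up j b 0 \<in> F")
        case False
        then have e0: "up j 0 0 \<in> E - F"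
          using up_E[OF v0] b0 by simp
        have "up j 0 1 \<noteq> up j 0 0"
          using inj_up[of j 0 UNIV] by (auto simp: inj_on_def)
        then have "own (up j 0 0) \<noteq> B j 0 0"
          using link_own[OF _ e1 e0 _ _ own1] v0 b0 up_no_hub j by auto
        then show ?thesis
          using own_in[OF e0] e0 b0 by (auto simp: up_def parent_def)
      next
        case up0: True
        obtain X m b' where X: "attached (ctr t (Suc j)) X" "X \<subseteq> from_unit (Suc j)"
            "z + 1 + l \<le> card X"
          and m: "Suc j \<le> m" "tip m b'" "linked F (ctr t (Suc j)) (B m b' z)"
          using safe(1) by (auto simp: anchored_def)
        have "linked F (ctr t j) (B j 0 0)"
          using up0 b0 linked_edge[of "ctr t j" "B j 0 0"] by (simp add: up_def parent_def insert_commute)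
        moreover have "linked F (B j 0 0) (ctr t (Suc j))"
          using True linked_edge by (simp add: link_def)
        ultimately have l: "linked F (ctr t j) y" if "linked F (ctr t (Suc j)) y" for y
          using that by (meson linked_trans)
        have "attached (ctr t j) X"
          using X(1) l by (auto simp: attached_def)
        moreover have "X \<subseteq> region j b"
          using X(2) b0 by (auto simp: region_def)
        moreover have "len b \<le> card X" "b = 0 \<and> j < m"
          using X(3) b0 len0 m(1) by auto
        ultimately have "hanging j b X"
          using m(2) l[OF m(3)] unfolding hanging_def by blast
        then show ?thesis
          using up0 by blast
      qed
    qed
  qed
qed

text \<open>The centre owns the top edges of the branches in \<open>C\<close>, so there are at most
  \<open>k\<close> of them, each costing at most \<open>z + 1\<close> edges; one of the
  \<open>k + 1\<close> legs remains, whence \<open>anchored\<close>. If the centre also owned the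
  preceding link, \<open>C\<close> would have at most \<open>k - 1\<close> elements, and two
  remaining legs would already give \<open>long_and_large\<close>.\<close>

lemma safe_step:
  assumes j: "1 \<le> j" "j \<le> L" and next_safe: "j < L \<Longrightarrow> safe (Suc j)"
    and not_good: "\<not> long_and_large"
  shows "safe j"
proof -
  define H where "H = {b. b < branches j \<and> up j b 0 \<in> F}"
  define C where "C = {b. b < branches j \<and> up j b 0 \<notin> F}"
  have fin: "finite H" "finite C" and HC: "H \<union> C = {..<branches j}" "H \<inter> C = {}"
    by (auto simp: H_def C_def)
  have br: "branches j = k + 1 + l"
    using j by (simp add: branches_def)
  have hang_j: "up j b 0 \<in> F \<and> (\<exists>X. hanging j b X) \<or> up j b 0 \<in> E - F \<and> own (up j b 0) = ctr t j"
    if "b < branches j" for b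
    by (rule hang[OF j next_safe not_good that])
  then have "\<forall>b\<in>H. \<exists>X. hanging j b X"
    by (auto simp: H_def)
  then obtain X where X: "\<And>b. b \<in> H \<Longrightarrow> hanging j b (X b)"
    by metis
  have XF: "X b \<subseteq> F" if "b \<in> H" for b
    using X[OF that] by (auto simp: hanging_def attached_def)
  have finX: "finite (X b)" if "b \<in> H" for b
    using XF[OF that] F_sub finite_E by (meson finite_subset)
  have disj: "X b \<inter> X b' = {}" if "b \<in> H" "b' \<in> H" "b \<noteq> b'" for b b'
    using X[OF that(1)] X[OF that(2)] that(3) region_disjoint XF[OF that(1)] F_sub
    unfolding hanging_def by blast
  have "card (\<Union>b\<in>H. X b) = (\<Sum>b\<in>H. card (X b))"
    using fin finX disj by (intro card_UN_disjoint) auto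
  moreover have "(\<Sum>b\<in>H. len b) \<le> (\<Sum>b\<in>H. card (X b))"
    using X by (intro sum_mono) (auto simp: hanging_def)
  moreover have "(\<Sum>b\<in>C. len b) \<le> card C * (z + 1)"
    using sum_bounded_above[of C len "z + 1"] by (simp add: len_def)
  moreover have "(\<Sum>b\<in>H. len b) + (\<Sum>b\<in>C. len b) = (k + 1) * (z + 1) + l"
    using sum.union_disjoint[OF fin HC(2), of len] HC(1) sum_len br by simp
  ultimately have card_X: "(k + 1) * (z + 1) + l \<le> card (\<Union>b\<in>H. X b) + card C * (z + 1)"
    by linarith
  have "{..k} - C \<subseteq> H \<inter> {..k}"
    using br by (auto simp: H_def C_def)
  then have "card ({..k} - C) \<le> card (H \<inter> {..k})"
    by (intro card_mono) auto
  moreover have "k + 1 - card C \<le> card ({..k} - C)"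
    using diff_card_le_card_Diff[OF fin(2), of "{..k}"] by simp
  ultimately have card_H: "k + 1 \<le> card (H \<inter> {..k}) + card C"
    by linarith
  have att: "attached (ctr t j) (\<Union>b\<in>H. X b)" "(\<Union>b\<in>H. X b) \<subseteq> from_unit j"
    using X region_from_unit unfolding hanging_def attached_def by blast+
  have tips: "\<exists>m b'. tip m b' \<and> linked F (ctr t j) (B m b' z) \<and> ((m, b') = (j, b) \<or> b = 0 \<and> j < m)"
    if "b \<in> H \<inter> {..k}" for b
    using X[of b] that by (auto simp: hanging_def)
  let ?O = "{e \<in> E - F. own e = ctr t j}"
  have up_O: "(\<lambda>b. up j b 0) ` C \<subseteq> ?O"
    using hang_j by (auto simp: C_def)
  have inj: "inj_on (\<lambda>b. up j b 0) C"
    using j by (auto simp: inj_on_def up_def parent_def ctr_def doubleton_eq_iff)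
  have finO: "finite ?O"
    using finite_E by auto
  have card_C: "card C \<le> k"
    using card_mono[OF finO up_O] own_card[of "ctr t j"] by (simp add: card_image[OF inj])
  have "anchored j"
  proof -
    have "card C * (z + 1) \<le> k * (z + 1)"
      using card_C by (rule mult_le_mono1)
    then have "z + 1 + l \<le> card (\<Union>b\<in>H. X b)"
      using card_X by (simp add: algebra_simps)
    moreover have "H \<inter> {..k} \<noteq> {}"
      using card_H card_C by auto
    then obtain b where "b \<in> H \<inter> {..k}"
      by blast
    then obtain m b' where "tip m b'" "linked F (ctr t j) (B m b' z)" "j \<le> m"
      using tips[of b] by auto
    ultimately show ?thesis
      using att unfolding anchored_def by blast
  qed
  moreover have "link (j - 1) \<in> F \<or> own (link (j - 1)) \<noteq> ctr t j"
  proof (rule ccontr)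
    assume "\<not> (link (j - 1) \<in> F \<or> own (link (j - 1)) \<noteq> ctr t j)"
    then have "link (j - 1) \<in> ?O"
      using link_E[of "j - 1"] j by auto
    moreover have "link (j - 1) \<notin> (\<lambda>b. up j b 0) ` C"
      using j by (auto simp: link_def up_def parent_def ctr_def doubleton_eq_iff)
    ultimately have "card C + 1 \<le> card ?O"
      using card_mono[OF finO, of "insert (link (j - 1)) ((\<lambda>b. up j b 0) ` C)"] up_O fin
      by (simp add: card_image[OF inj])
    then have C1: "card C + 1 \<le> k"
      using own_card[of "ctr t j"] by linarith
    then have "(card C + 1) * (z + 1) \<le> k * (z + 1)"
      by (rule mult_le_mono1)
    then have large: "2 * (z + 1) + l \<le> card (\<Union>b\<in>H. X b)"
      using card_X by (simp add: algebra_simps)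
    have "2 \<le> card (H \<inter> {..k})"
      using card_H C1 by linarith
    then obtain b1 b2 where b: "b1 \<in> H \<inter> {..k}" "b2 \<in> H \<inter> {..k}" "b1 \<noteq> b2"
      by (rule two_of_card)
    obtain m1 c1 where 1: "tip m1 c1" "linked F (ctr t j) (B m1 c1 z)"
        "(m1, c1) = (j, b1) \<or> b1 = 0 \<and> j < m1"
      using tips[OF b(1)] by blast
    obtain m2 c2 where 2: "tip m2 c2" "linked F (ctr t j) (B m2 c2 z)"
        "(m2, c2) = (j, b2) \<or> b2 = 0 \<and> j < m2"
      using tips[OF b(2)] by blast
    \<comment> \<open>Only leg 0 can supply a tip of a later unit, so different legs supply
      different tips.\<close>
    have "(m1, c1) \<noteq> (m2, c2)"
      using 1(3) 2(3) b(3) by auto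
    then have long_and_large
      using large att(1) 1(1,2) 2(1,2) unfolding long_and_large_def by blast
    then show False
      using not_good by simp
  qed
  ultimately show ?thesis
    by (simp add: safe_def)
qed

lemma chain_long_and_large: long_and_large
proof (rule ccontr)
  assume not_good: "\<not> long_and_large"
  \<comment> \<open>The induction goes up the chain: \<open>Suc (L - n)\<close> runs from
    \<open>L\<close> down to 1.\<close>
  have "safe (Suc (L - n))" if "1 \<le> n" "n \<le> L" for n
    using that
  proof (induction n rule: nat_induct_at_least)
    case base
    show ?case
      by (rule safe_step[OF _ _ _ not_good]) (use base L_pos in auto)
  next
    case (Suc n)
    have eq: "L - n = Suc (L - Suc n)"
      using Suc.prems by simp
    show ?case
      by (rule safe_step[OF _ _ _ not_good]) (use Suc eq in auto)
  qed
  from this[of L] have safe: "anchored 1" "link 0 \<in> F \<or> own (link 0) \<noteq> ctr t 1"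
    using L_pos by (auto simp: safe_def)
  have v: "valid t 0 0 i" if "i \<le> z" for i
    using that by (simp add: valid_0)
  \<comment> \<open>The first vertex of the extra leg has \<open>Hub 0\<close> as its parent, so it
    is full and cannot own the link; by \<open>safe\<close> the first centre does not own it
    either.\<close>
  have "link 0 \<in> F"
  proof (rule ccontr)
    assume "link 0 \<notin> F"
    then have e: "link 0 \<in> E - F"
      using link_E by simp
    have "own (link 0) \<noteq> B 0 0 0"
      by (rule full_own[OF v _ e]) (use L_pos in \<open>auto simp: full_def link_no_hub\<close>)
    then show False
      using own_in[OF e] safe(2) e by (auto simp: link_def)
  qed
  moreover have "up 0 0 i \<in> F" if "0 < i" "i \<le> z" for i
    using up_in_F[OF v[OF that(2)]] that by (simp add: full_def)
  ultimately show False
    using push[OF L_pos] safe(1) not_good by simp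
qed

section \<open>The distance between two tips\<close>

definition chain_verts :: "nat set" where
  "chain_verts = range (Centre t) \<union> {B j b i |j b i. True}"

text \<open>An edge could leave the chain only through a hub, and \<open>clean\<close> keeps such
  edges out of \<open>F\<close>.\<close>

lemma F_closed:
  assumes "{x, y} \<in> F" "x \<in> chain_verts"
  shows "y \<in> chain_verts"
proof -
  have "{x, y} \<in> E"
    using assms F_sub by auto
  then obtain t' j b i w where e: "{x, y} = {Branch t' j b i, w}" "valid t' j b i" "w \<in> targets t' j b i"
    by (rule E_cases)
  have t: "t' = t"
    using e(1,3) assms(2)
    by (auto simp: chain_verts_def doubleton_eq_iff targets_def parent_def exit_def ctr_def split: if_splits)
  have "w \<noteq> Hub s" for s
    using clean[of j b i s] e assms(1) unfolding t by auto
  then have "w \<in> chain_verts"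
    using e(3) t by (auto simp: chain_verts_def targets_def parent_def exit_def ctr_def split: if_splits)
  then show ?thesis
    using e(1) t by (auto simp: chain_verts_def doubleton_eq_iff)
qed

lemma linked_closed: "linked F x y \<Longrightarrow> x \<in> chain_verts \<Longrightarrow> y \<in> chain_verts"
  unfolding linked_def by (induction rule: rtranclp_induct) (auto intro: F_closed)

text \<open>A walk can leave a leg only through its first vertex, so the distance from a tip is at least
  this potential, which does not see the rest of the chain.\<close>

definition potential :: "nat \<Rightarrow> nat \<Rightarrow> nat \<Rightarrow> nat" where
  "potential m b x = (case from_nat x of HubNode s \<Rightarrow> 0 | CentreNode t j \<Rightarrow> z + 1
     | BranchNode t j b' i \<Rightarrow> if (j, b') = (m, b) then z - i else z + 2 + i)"

lemma potential_simps [simp]: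
  "potential m b (Centre t' j) = z + 1"
  "potential m b (Branch t' j b' i) = (if (j, b') = (m, b) then z - i else z + 2 + i)"
  by (auto simp: potential_def Centre_def Branch_def)

text \<open>The restriction to the chain excludes hubs, whose default potential 0 would violate the
  bound.\<close>

lemma potential_lipschitz:
  assumes "{x, y} \<in> F" "x \<in> chain_verts"
  shows "potential m b y \<le> potential m b x + 1"
proof -
  have "y \<in> chain_verts"
    by (rule F_closed[OF assms])
  then have no_hub: "x \<noteq> Hub s" "y \<noteq> Hub s" for s
    using assms(2) by (auto simp: chain_verts_def)
  have "{x, y} \<in> E"
    using assms F_sub by auto
  then obtain t' j c i w where e: "{x, y} = {Branch t' j c i, w}" "valid t' j c i" "w \<in> targets t' j c i"
    by (rule E_cases)
  have "w \<noteq> Hub s" for s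
    using e(1) no_hub by (auto simp: doubleton_eq_iff)
  \<comment> \<open>A first vertex of a branch has potential \<open>z\<close> or
    \<open>z + 2\<close>, one away from the \<open>z + 1\<close> of every centre.\<close>
  then consider j' where "w = Centre t' j'" "i = 0" | "i \<noteq> 0" "w = Branch t' j c (i - 1)"
    using e(3) by (auto simp: targets_def parent_def exit_def ctr_def split: if_splits)
  then have "potential m b w \<le> potential m b (Branch t' j c i) + 1 \<and>
      potential m b (Branch t' j c i) \<le> potential m b w + 1"
    by cases (auto split: if_splits)
  then show ?thesis
    using e(1) by (auto simp: doubleton_eq_iff)
qed

lemma large_component:
  assumes G: "simple_graph G" "verts G = V" "edges G = F"
  shows "\<exists>K. component K G \<and> 2 * (z + 1) + l \<le> card (edges K) \<and> 2 * (z + 1) \<le> diam K"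
proof -
  obtain r X m b m' b' where X: "attached r X" "2 * (z + 1) + l \<le> card X"
    and tips: "tip m b" "tip m' b'" "(m, b) \<noteq> (m', b')"
    and linked: "linked F r (B m b z)" "linked F r (B m' b' z)"
    using chain_long_and_large unfolding long_and_large_def by blast
  have tip_V: "B m b z \<in> V" "B m' b' z \<in> V"
    using tips by (auto simp: tip_def V_def)
  have r: "r \<in> verts G"
    using linked_in_verts[OF linked_sym] linked(1) G tip_V(1) by metis
  let ?K = "component_of G r"
  have K: "component ?K G"
    by (rule component_component_of[OF G(1) r])
  have "X \<subseteq> edges ?K"
    using X(1) G(3) by (auto simp: attached_def component_of_def)
  moreover have "finite (edges ?K)"
    using finite_E F_sub G(3) by (auto simp: component_of_def intro: finite_subset)
  ultimately have "2 * (z + 1) + l \<le> card (edges ?K)"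
    using X(2) card_mono le_trans by blast
  moreover have "2 * (z + 1) \<le> diam ?K"
  proof (rule diam_ge)
    show "connected_graph ?K" "finite (verts ?K)"
      using K by (auto simp: component_def subgraph_def simple_graph_def)
    show "B m b z \<in> verts ?K" "B m' b' z \<in> verts ?K"
      using linked tip_V G by (auto simp: component_of_def)
    fix xs assume xs: "walk_between ?K (B m b z) xs (B m' b' z)"
    have "potential m b y \<le> potential m b x + 1" if "{x, y} \<in> edges ?K" for x y
    proof (rule potential_lipschitz)
      show "{x, y} \<in> F"
        using that G(3) by (simp add: component_of_def)
      have "linked F r x"
        using that G(3) by (simp add: component_of_def)
      then have "linked F (B m b z) x"
        using linked(1) by (meson linked_sym linked_trans)
      then show "x \<in> chain_verts"
        by (rule linked_closed) (auto simp: chain_verts_def)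
    qed
    then have "potential m b (last xs) < potential m b (hd xs) + length xs"
      using xs by (intro walk_potential[of "edges ?K"]) (auto simp: walk_between_def)
    \<comment> \<open>The potential is 0 at the starting tip and \<open>2 * z + 2\<close> at the
      other.\<close>
    then show "2 * (z + 1) < length xs"
      using xs tips(3) by (auto simp: walk_between_def split: if_splits)
  qed
  ultimately show ?thesis
    using K by blast
qed

end

section \<open>Owners in a decomposition and the choice of a chain\<close>

lemma degree_le_max_degree:
  assumes "finite (verts G)" "v \<in> verts G"
  shows "degree G v \<le> max_degree G"
  unfolding max_degree_def using assms by (intro Max_ge) auto

text \<open>A vertex owns at most one edge of each part, and \<open>k\<close> parts remain besides
  \<open>P f\<close>.\<close>

lemma decomposition_owner:
  assumes dec: "pseudoforest_decomposition G (k + 1) P" and f: "f < k + 1" and fin: "finite (edges G)"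
  shows "\<exists>own. (\<forall>e\<in>edges G - edges (P f). own e \<in> e) \<and>
           (\<forall>x. card {e \<in> edges G - edges (P f). own e = x} \<le> k)"
proof -
  have "\<forall>i<k + 1. \<exists>own. (\<forall>e\<in>edges (P i). own e \<in> e) \<and> inj_on own (edges (P i))"
    using dec pseudoforest_owner by (auto simp: pseudoforest_decomposition_def)
  then obtain own where own: "\<And>i e. i < k + 1 \<Longrightarrow> e \<in> edges (P i) \<Longrightarrow> own i e \<in> e"
    and inj: "\<And>i. i < k + 1 \<Longrightarrow> inj_on (own i) (edges (P i))"
    by metis
  have un: "(\<Union>i<k + 1. edges (P i)) = edges G"
    using dec by (simp add: pseudoforest_decomposition_def)
  then have "\<forall>e\<in>edges G. \<exists>i<k + 1. e \<in> edges (P i)"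
    by blast
  then obtain part where part: "\<And>e. e \<in> edges G \<Longrightarrow> part e < k + 1 \<and> e \<in> edges (P (part e))"
    by metis
  define own' where "own' e = own (part e) e" for e
  have "card {e \<in> edges G - edges (P f). own' e = x} \<le> k" for x
  proof -
    have "inj_on part {e \<in> edges G - edges (P f). own' e = x}"
    proof (rule inj_onI)
      fix e e'
      assume e: "e \<in> {e \<in> edges G - edges (P f). own' e = x}"
        and e': "e' \<in> {e \<in> edges G - edges (P f). own' e = x}" and eq: "part e = part e'"
      then have "own (part e) e = own (part e) e'"
        by (simp add: own'_def)
      then show "e = e'"
        using inj[of "part e"] part[of e] part[of e'] e e' eq by (auto simp: inj_on_def)
    qed
    moreover have "part ` {e \<in> edges G - edges (P f). own' e = x} \<subseteq> {..<k + 1} - {f}"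
      using part by auto
    ultimately have "card {e \<in> edges G - edges (P f). own' e = x} \<le> card ({..<k + 1} - {f})"
      by (intro card_inj_on_le) auto
    then show ?thesis
      using f by simp
  qed
  moreover have "own' e \<in> e" if "e \<in> edges G" for e
    using own part that by (auto simp: own'_def)
  ultimately show ?thesis
    by blast
qed

context chains
begin

text \<open>A hub meets at most \<open>D\<close> edges of \<open>F\<close> and owns at most
  \<open>k\<close> others, so at most \<open>k * (D + k)\<close> edges are bad. An edge between a
  hub and a branch vertex spoils only one chain, and there are more chains than bad edges.\<close>

lemma exists_clean_chain:
  assumes F: "F \<subseteq> E" and own: "\<And>e. e \<in> E - F \<Longrightarrow> own e \<in> e"
    "\<And>x. card {e \<in> E - F. own e = x} \<le> k"
    and deg: "\<And>x. x \<in> V \<Longrightarrow> card {e \<in> F. x \<in> e} \<le> D" and N: "k * (D + k) < N"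
  shows "\<exists>t. clean_chain k z l N L F own t"
proof -
  define Bad where "Bad = (\<Union>s<k. {e \<in> F. Hub s \<in> e} \<union> {e \<in> E - F. own e = Hub s})"
  have finF: "finite F"
    using F finite_E finite_subset by blast
  have "card ({e \<in> F. Hub s \<in> e} \<union> {e \<in> E - F. own e = Hub s}) \<le> D + k" if "s < k" for s
  proof -
    have "Hub s \<in> V"
      using that by (auto simp: V_def)
    then show ?thesis
      using deg[of "Hub s"] own(2)[of "Hub s"] card_Un_le le_trans add_mono by meson
  qed
  then have "(\<Sum>s<k. card ({e \<in> F. Hub s \<in> e} \<union> {e \<in> E - F. own e = Hub s})) \<le> k * (D + k)"
    using sum_bounded_above[of "{..<k}" _ "D + k"] by fastforce
  then have card_Bad: "card Bad \<le> k * (D + k)"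
    unfolding Bad_def using card_UN_le[of "{..<k}"] le_trans by blast
  have fin_Bad: "finite Bad"
    unfolding Bad_def using finF finite_E by auto
  define clean where "clean t \<longleftrightarrow> (\<forall>j b i s. valid t j b i \<longrightarrow> Hub s \<in> targets t j b i \<longrightarrow>
      {Branch t j b i, Hub s} \<notin> F \<and> own {Branch t j b i, Hub s} \<noteq> Hub s)" for t
  have "\<exists>t<N. clean t"
  proof (rule ccontr)
    assume no: "\<not> (\<exists>t<N. clean t)"
    have "\<exists>e\<in>Bad. \<exists>j b i s. e = {Branch t j b i, Hub s}" if t: "t < N" for t
    proof -
      obtain j b i s where *: "valid t j b i" "Hub s \<in> targets t j b i"
        "{Branch t j b i, Hub s} \<in> F \<or> own {Branch t j b i, Hub s} = Hub s"
        using no t unfolding clean_def by blast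
      have "s < k"
        using *(2) k_ge_2 by (auto simp: targets_def parent_def exit_def ctr_def split: if_splits)
      then have "{Branch t j b i, Hub s} \<in> Bad"
        using * E_I[OF *(1,2)] by (auto simp: Bad_def)
      then show ?thesis
        by blast
    qed
    then obtain g where g: "\<And>t. t < N \<Longrightarrow> g t \<in> Bad \<and> (\<exists>j b i s. g t = {Branch t j b i, Hub s})"
      by metis
    have "inj_on g {..<N}"
    proof (rule inj_onI)
      fix t t' assume t: "t \<in> {..<N}" "t' \<in> {..<N}" "g t = g t'"
      obtain j b i s where "g t = {Branch t j b i, Hub s}"
        using g[of t] t by auto
      moreover obtain j' b' i' s' where "g t' = {Branch t' j' b' i', Hub s'}"
        using g[of t'] t by auto
      ultimately have "{Branch t j b i, Hub s} = {Branch t' j' b' i', Hub s'}"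
        using t(3) by metis
      then show "t = t'"
        by (simp add: doubleton_eq_iff)
    qed
    then have "card {..<N} \<le> card Bad"
      using g fin_Bad by (intro card_inj_on_le) auto
    then show False
      using card_Bad N by simp
  qed
  then obtain t where "t < N" "clean t"
    by blast
  then have "clean_chain k z l N L F own t"
    using F own by unfold_locales (auto simp only: clean_def)
  then show ?thesis ..
qed

end

theorem theorem1p9:
  fixes k D d z :: nat and \<epsilon> :: real
  assumes "k \<ge> 2"
    and "int z \<le> \<lfloor>(real d - 1) / (real k + 1)\<rfloor>"
    and "\<epsilon> > 0"
  shows "\<exists>G :: nat ugraph.
     simple_graph G \<and>
     fractional_arboricity G < real k + real d / (real d + real k + 1) + \<epsilon> \<and>
     (\<forall>P. pseudoforest_decomposition G (k + 1) P \<longrightarrow>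
        (\<forall>i<k + 1. max_degree (P i) \<le> D \<longrightarrow>
           (\<exists>K. component K (P i) \<and>
                int (card (edges K)) \<ge> int d - int z * (int k - 1) + 1 \<and>
                diam K \<ge> 2 * (z + 1))))"
proof -
  have "real z \<le> (real d - 1) / (real k + 1)"
    using assms(2) by (simp add: le_floor_iff)
  then have "real z * (real k + 1) \<le> real d - 1"
    by (simp add: pos_le_divide_eq)
  then have "real (z * (k + 1) + 1) \<le> real d"
    by (simp add: algebra_simps)
  then have "z * (k + 1) + 1 \<le> d"
    by (simp only: of_nat_le_iff)
  \<comment> \<open>The bound on \<open>z\<close> says exactly that this number of pendant vertices
    is nonnegative.\<close>
  then obtain l where d: "d = l + z * (k + 1) + 1"
    by (metis add.assoc add.commute le_Suc_ex)
  \<comment> \<open>One chain more than bad edges can spoil. \<open>N\<close> is fixed before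
    \<open>L\<close>, which must be large enough to make the surplus of \<open>N\<close> extra legs
    negligible.\<close>
  define N where "N = Suc (k * (D + k))"
  obtain L where L: "real N < \<epsilon> * real L"
    using ex_less_of_nat_mult[OF assms(3), of "real N"] by (auto simp: mult.commute)
  then have "0 < L"
    using gr0I by fastforce
  then interpret chains k z l N L
    using assms(1) by unfold_locales
  let ?G = "UGraph V E"
  have \<rho>: "\<rho> = real k + real d / (real d + real k + 1)"
    unfolding \<rho>_def d_def d by simp
  have "\<exists>K. component K (P i) \<and> int (card (edges K)) \<ge> int d - int z * (int k - 1) + 1 \<and>
      diam K \<ge> 2 * (z + 1)"
    if dec: "pseudoforest_decomposition ?G (k + 1) P" and i: "i < k + 1"
      and max_deg: "max_degree (P i) \<le> D" for P i
  proof -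
    have Pi: "simple_graph (P i)" "verts (P i) = V" "edges (P i) \<subseteq> E"
      using dec i by (auto simp: pseudoforest_decomposition_def pseudoforest_def)
    obtain own where own: "\<And>e. e \<in> E - edges (P i) \<Longrightarrow> own e \<in> e"
      "\<And>x. card {e \<in> E - edges (P i). own e = x} \<le> k"
      using decomposition_owner[OF dec i] finite_E by auto
    have "card {e \<in> edges (P i). x \<in> e} \<le> D" if "x \<in> V" for x
      using degree_le_max_degree[of "P i" x] that Pi(2) finite_V max_deg by (simp add: degree_def)
    then obtain t where "clean_chain k z l N L (edges (P i)) own t"
      using exists_clean_chain[OF Pi(3) own] by (auto simp: N_def)
    then interpret clean_chain k z l N L "edges (P i)" own t .
    obtain K where K: "component K (P i)" "2 * (z + 1) + l \<le> card (edges K)" "2 * (z + 1) \<le> diam K"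
      using large_component[OF Pi(1,2) refl] by blast
    have "int d - int z * (int k - 1) + 1 = int (2 * (z + 1) + l)"
      by (simp add: d algebra_simps)
    also have "\<dots> \<le> int (card (edges K))"
      using K(2) by (simp only: of_nat_le_iff)
    finally show ?thesis
      using K by blast
  qed
  then show ?thesis
    using simple fractional_arboricity_less[OF assms(3) L] unfolding \<rho> by blast
qed

end
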